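(* Let $\Omega\subset\mathbb{R}^N$, $N\ge 2$, be a region satisfying (B2), let $\{b_j:j\ge1\}$ be a sequence of $\Delta$-orthonormal DBS eigenfunctions constructed as in the context with DBS eigenvalues $q_j$, and put $h_j:=\Delta b_j$, $w_j:=\sqrt{q_j|\partial\Omega|}\,D_\nu b_j$. Let $E_H:L^2(\partial\Omega,d\sigma)\to L^2_H(\Omega)$ be the harmonic extension operator and, for finite $M\ge 1$, define $$P_M(x,z):=\sum_{j=1}^M\frac{h_j(x)}{\sqrt{|\partial\Omega|\,q_j}}\,w_j(z),\qquad E_Mg(x):=\int_{\partial\Omega}P_M(x,z)\,g(z)\,d\sigma(z).$$ Then $$\|E_Hg-E_Mg\|\le\sqrt{\frac{|\partial\Omega|}{q_{M+1}}}\;\|g-g_M\|_{\partial\Omega}\qquad\text{for all } g\in L^2(\partial\Omega,d\sigma),$$ where $\|\cdot\|$ is the $L^2(\Omega)$ norm, $q_{M+1}$ is the $(M+1)$-st DBS eigenvalue and $g_M:=\sum_{j=1}^M\hat g_jw_j$ with $\hat g_j:=\langle g,w_j\rangle_{\partial\Omega}$.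
   Context: A region is a nonempty connected open subset of $\mathbb{R}^N$. All functions are real valued and derivatives are weak. (B1): $\Omega$ is bounded and $\partial\Omega$ is the union of a finite number of disjoint closed Lipschitz surfaces, each having finite surface area. $\sigma$ is $(N-1)$-dimensional Hausdorff measure on $\partial\Omega$, $|\partial\Omega|:=\sigma(\partial\Omega)$, $\nu$ is the outward unit normal, $\gamma$ the boundary trace on $H^1(\Omega)$. $\langle u,v\rangle_{\partial\Omega}:=|\partial\Omega|^{-1}\int_{\partial\Omega}uv\,d\sigma$ and $\|g\|_{\partial\Omega}:=\langle g,g\rangle_{\partial\Omega}^{1/2}$. $H_0(\Delta,\Omega)=\{u\in H_0^1(\Omega):\Delta u\in L^2(\Omega)\}$ ($\Delta$ the weak Laplacian), a Hilbert space with inner product $[u,v]_\Delta:=a(u,v):=\int_\Omega\Delta u\,\Delta v\,dx$ and norm $\|u\|_\Delta$. "$\Delta$-orthonormal" refers to $[\cdot,\cdot]_\Delta$. For $u\in H_0(\Delta,\Omega)$, $D_\nu u\in L^2(\partial\Omega,d\sigma)$ is the normal derivative determined by $\int_{\partial\Omega}\gamma(v)D_\nu u\,d\sigma=\int_\Omega(\nabla u\cdot\nabla v+v\Delta u)\,dx$ for all $v\in H^1(\Omega)$. (B2): (B1) holds and $D_\nu$ is a compact mapping of $H_0(\Delta,\Omega)$ into $L^2(\partial\Omega,d\sigma)$. A DBS (Dirichlet Biharmonic Steklov) eigenvalue/eigenfunction is a pair $(q,b)\in\mathbb{R}\times H_0(\Delta,\Omega)$ with $b\ne 0$ and $\int_\Omega\Delta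 b\,\Delta v\,dx=q\int_{\partial\Omega}D_\nu b\,D_\nu v\,d\sigma$ for all $v\in H_0(\Delta,\Omega)$. Construction of $\{b_j\}$: put $\mathcal{M}(u):=\int_{\partial\Omega}|D_\nu u|^2\,d\sigma$. For $k=1,2,\dots$, given $b_1,\dots,b_{k-1}$, let $C_k:=\{u\in H_0(\Delta,\Omega):\|u\|_\Delta\le 1,\ a(u,b_j)=0\text{ for }1\le j\le k-1\}$, $\beta_k:=\sup_{C_k}\mathcal{M}$, and let $b_k\in C_k$ be a maximizer of $\mathcal{M}$ on $C_k$. The $b_k$ are $\Delta$-orthonormal DBS eigenfunctions with eigenvalues $q_k=1/\beta_k$ (listed with multiplicity, $q_1\le q_2\le\cdots$). $L^2_H(\Omega)$ (the harmonic Bergman space) is the space of all $u\in L^2(\Omega)$ with $\int_\Omega u\,\Delta v\,dx=0$ for all $v\in C_c^2(\Omega)$. The harmonic extension operator $E_H$ is $$E_Hg:=\sqrt{|\partial\Omega|}\sum_{j=1}^\infty\frac{\hat g_j}{\sqrt{q_j}}\,h_j,\qquad \hat g_j:=\langle g,w_j\rangle_{\partial\Omega}.$$ *)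

theory Defs
  imports "HOL-Analysis.Analysis"
begin

text \<open>Elements of the function spaces below are represented by functions; two functions that
  agree almost everywhere represent the same element.\<close>

definition L2 :: "'a measure \<Rightarrow> ('a \<Rightarrow> real) set" where
  "L2 M = {u \<in> borel_measurable M. integrable M (\<lambda>x. (u x)\<^sup>2)}"

definition L2_norm :: "'a measure \<Rightarrow> ('a \<Rightarrow> real) \<Rightarrow> real" where
  "L2_norm M u = sqrt (LINT x|M. (u x)\<^sup>2)"

text \<open>The normalisation is the usual one, for which the \<open>k\<close>-dimensional Hausdorff measure on a
  \<open>k\<close>-dimensional Euclidean space is Lebesgue measure.  Boundedness of the covering sets is required
  because \<^const>\<open>diameter\<close> is not meaningful for unbounded sets.\<close>

definition hausdorff_outer :: "nat \<Rightarrow> 'a::euclidean_space set \<Rightarrow> ennreal" where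
  "hausdorff_outer k S =
    (SUP \<delta>\<in>{0<..}. INF A\<in>{A :: nat \<Rightarrow> 'a set. S \<subseteq> (\<Union>i. A i) \<and>
        (\<forall>i. bounded (A i) \<and> diameter (A i) \<le> \<delta>)}.
      (\<Sum>i. if A i = {} then 0
             else ennreal (unit_ball_vol (real k) * (diameter (A i) / 2) ^ k)))"

text \<open>\<^const>\<open>hausdorff_outer\<close> is a metric outer measure, hence countably additive on Borel sets.\<close>

definition hausdorff_measure :: "nat \<Rightarrow> 'a::euclidean_space measure" where
  "hausdorff_measure k = measure_of UNIV (sets borel) (hausdorff_outer k)"

definition surface_measure :: "'a::euclidean_space set \<Rightarrow> 'a measure" where
  "surface_measure \<Omega> = restrict_space (hausdorff_measure (DIM('a) - 1)) (frontier \<Omega>)"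

definition surface_area :: "'a::euclidean_space set \<Rightarrow> real" where
  "surface_area \<Omega> = measure (surface_measure \<Omega>) (frontier \<Omega>)"

definition bdry_inner :: "'a::euclidean_space set \<Rightarrow> ('a \<Rightarrow> real) \<Rightarrow> ('a \<Rightarrow> real) \<Rightarrow> real" where
  "bdry_inner \<Omega> u v = (LINT z|surface_measure \<Omega>. u z * v z) / surface_area \<Omega>"

definition bdry_norm :: "'a::euclidean_space set \<Rightarrow> ('a \<Rightarrow> real) \<Rightarrow> real" where
  "bdry_norm \<Omega> g = sqrt (bdry_inner \<Omega> g g)"

definition region :: "'a::euclidean_space set \<Rightarrow> bool" where
  "region \<Omega> \<longleftrightarrow> open \<Omega> \<and> connected \<Omega> \<and> \<Omega> \<noteq> {}"

text \<open>Locally, after a rotation taking the unit vector \<open>e\<close> to the last coordinate direction, the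
  surface is the graph of a Lipschitz function \<open>\<phi>\<close> on the hyperplane orthogonal to \<open>e\<close>.\<close>

definition closed_lipschitz_surface :: "'a::euclidean_space set \<Rightarrow> bool" where
  "closed_lipschitz_surface S \<longleftrightarrow> compact S \<and> connected S \<and> S \<noteq> {} \<and>
    (\<forall>p\<in>S. \<exists>e r L (\<phi> :: 'a \<Rightarrow> real). norm e = 1 \<and> 0 < r \<and> L-lipschitz_on {y. y \<bullet> e = 0} \<phi> \<and>
      S \<inter> ball p r = {x \<in> ball p r. x \<bullet> e = \<phi> (x - (x \<bullet> e) *\<^sub>R e)})"

definition B1 :: "'a::euclidean_space set \<Rightarrow> bool" where
  "B1 \<Omega> \<longleftrightarrow> bounded \<Omega> \<and>
    (\<exists>F. finite F \<and> disjoint F \<and> \<Union>F = frontier \<Omega> \<and>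
      (\<forall>S\<in>F. closed_lipschitz_surface S \<and> emeasure (hausdorff_measure (DIM('a) - 1)) S < \<infinity>))"

definition pd :: "'a::euclidean_space \<Rightarrow> ('a \<Rightarrow> real) \<Rightarrow> 'a \<Rightarrow> real" where
  "pd i \<phi> x = frechet_derivative \<phi> (at x) i"

definition C1 :: "('a::euclidean_space \<Rightarrow> real) set" where
  "C1 = {\<phi>. (\<forall>x. \<phi> differentiable (at x)) \<and> (\<forall>i\<in>Basis. continuous_on UNIV (pd i \<phi>))}"

definition C2 :: "('a::euclidean_space \<Rightarrow> real) set" where
  "C2 = {\<phi> \<in> C1. \<forall>i\<in>Basis. pd i \<phi> \<in> C1}"

text \<open>Compactly supported functions on \<open>\<Omega>\<close> are identified with their extensions by zero.\<close>

definition compact_supp :: "'a::euclidean_space set \<Rightarrow> ('a \<Rightarrow> real) set" where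
  "compact_supp \<Omega> = {\<phi>. \<exists>K. compact K \<and> K \<subseteq> \<Omega> \<and> (\<forall>x. x \<notin> K \<longrightarrow> \<phi> x = 0)}"

definition Cc1 :: "'a::euclidean_space set \<Rightarrow> ('a \<Rightarrow> real) set" where
  "Cc1 \<Omega> = C1 \<inter> compact_supp \<Omega>"

definition Cc2 :: "'a::euclidean_space set \<Rightarrow> ('a \<Rightarrow> real) set" where
  "Cc2 \<Omega> = C2 \<inter> compact_supp \<Omega>"

definition classical_laplacian :: "('a::euclidean_space \<Rightarrow> real) \<Rightarrow> 'a \<Rightarrow> real" where
  "classical_laplacian \<phi> x = (\<Sum>i\<in>Basis. pd i (pd i \<phi>) x)"

definition is_weak_gradient ::
    "'a::euclidean_space set \<Rightarrow> ('a \<Rightarrow> real) \<Rightarrow> ('a \<Rightarrow> 'a) \<Rightarrow> bool" where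
  "is_weak_gradient \<Omega> u G \<longleftrightarrow> (\<forall>i\<in>Basis. (\<lambda>x. G x \<bullet> i) \<in> L2 (lebesgue_on \<Omega>) \<and>
    (\<forall>\<phi>\<in>Cc1 \<Omega>. (LINT x|lebesgue_on \<Omega>. u x * pd i \<phi> x)
      = - (LINT x|lebesgue_on \<Omega>. (G x \<bullet> i) * \<phi> x)))"

definition weak_gradient :: "'a::euclidean_space set \<Rightarrow> ('a \<Rightarrow> real) \<Rightarrow> 'a \<Rightarrow> 'a" where
  "weak_gradient \<Omega> u = (SOME G. is_weak_gradient \<Omega> u G)"

definition is_weak_laplacian ::
    "'a::euclidean_space set \<Rightarrow> ('a \<Rightarrow> real) \<Rightarrow> ('a \<Rightarrow> real) \<Rightarrow> bool" where
  "is_weak_laplacian \<Omega> u f \<longleftrightarrow> f \<in> L2 (lebesgue_on \<Omega>) \<and>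
    (\<forall>\<phi>\<in>Cc2 \<Omega>. (LINT x|lebesgue_on \<Omega>. u x * classical_laplacian \<phi> x)
      = (LINT x|lebesgue_on \<Omega>. f x * \<phi> x))"

definition weak_laplacian :: "'a::euclidean_space set \<Rightarrow> ('a \<Rightarrow> real) \<Rightarrow> 'a \<Rightarrow> real" where
  "weak_laplacian \<Omega> u = (SOME f. is_weak_laplacian \<Omega> u f)"

definition H1 :: "'a::euclidean_space set \<Rightarrow> ('a \<Rightarrow> real) set" where
  "H1 \<Omega> = {u \<in> L2 (lebesgue_on \<Omega>). \<exists>G. is_weak_gradient \<Omega> u G}"

definition H1_norm :: "'a::euclidean_space set \<Rightarrow> ('a \<Rightarrow> real) \<Rightarrow> real" where
  "H1_norm \<Omega> u = sqrt (LINT x|lebesgue_on \<Omega>. (u x)\<^sup>2 + (norm (weak_gradient \<Omega> u x))\<^sup>2)"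

definition H10 :: "'a::euclidean_space set \<Rightarrow> ('a \<Rightarrow> real) set" where
  "H10 \<Omega> = {u \<in> H1 \<Omega>. \<exists>\<phi>. (\<forall>n. \<phi> n \<in> Cc1 \<Omega>) \<and>
    (\<lambda>n::nat. H1_norm \<Omega> (\<lambda>x. \<phi> n x - u x)) \<longlonglongrightarrow> 0}"

text \<open>The trace is the continuous extension to \<open>H1 \<Omega>\<close> of the map restricting
  functions in \<open>H1 \<Omega> \<inter> C(closure \<Omega>)\<close> to the boundary; it is given here through its graph.\<close>

definition is_trace ::
    "'a::euclidean_space set \<Rightarrow> ('a \<Rightarrow> real) \<Rightarrow> ('a \<Rightarrow> real) \<Rightarrow> bool" where
  "is_trace \<Omega> v t \<longleftrightarrow> v \<in> H1 \<Omega> \<and> t \<in> L2 (surface_measure \<Omega>) \<and>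
    (\<exists>\<phi>. (\<forall>n. \<phi> n \<in> H1 \<Omega> \<and> continuous_on (closure \<Omega>) (\<phi> n)) \<and>
      (\<lambda>n::nat. H1_norm \<Omega> (\<lambda>x. \<phi> n x - v x)) \<longlonglongrightarrow> 0 \<and>
      (\<lambda>n. L2_norm (surface_measure \<Omega>) (\<lambda>z. \<phi> n z - t z)) \<longlonglongrightarrow> 0)"

definition L2H :: "'a::euclidean_space set \<Rightarrow> ('a \<Rightarrow> real) set" where
  "L2H \<Omega> = {u \<in> L2 (lebesgue_on \<Omega>).
    \<forall>v\<in>Cc2 \<Omega>. (LINT x|lebesgue_on \<Omega>. u x * classical_laplacian v x) = 0}"

definition H0Delta :: "'a::euclidean_space set \<Rightarrow> ('a \<Rightarrow> real) set" where
  "H0Delta \<Omega> = {u \<in> H10 \<Omega>. \<exists>f. is_weak_laplacian \<Omega> u f}"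

definition inner_Delta :: "'a::euclidean_space set \<Rightarrow> ('a \<Rightarrow> real) \<Rightarrow> ('a \<Rightarrow> real) \<Rightarrow> real" where
  "inner_Delta \<Omega> u v = (LINT x|lebesgue_on \<Omega>. weak_laplacian \<Omega> u x * weak_laplacian \<Omega> v x)"

definition norm_Delta :: "'a::euclidean_space set \<Rightarrow> ('a \<Rightarrow> real) \<Rightarrow> real" where
  "norm_Delta \<Omega> u = sqrt (inner_Delta \<Omega> u u)"

definition is_normal_deriv ::
    "'a::euclidean_space set \<Rightarrow> ('a \<Rightarrow> real) \<Rightarrow> ('a \<Rightarrow> real) \<Rightarrow> bool" where
  "is_normal_deriv \<Omega> u d \<longleftrightarrow> d \<in> L2 (surface_measure \<Omega>) \<and>
    (\<forall>v\<in>H1 \<Omega>. \<forall>t. is_trace \<Omega> v t \<longrightarrow>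
      (LINT z|surface_measure \<Omega>. t z * d z)
        = (LINT x|lebesgue_on \<Omega>. weak_gradient \<Omega> u x \<bullet> weak_gradient \<Omega> v x
                                    + v x * weak_laplacian \<Omega> u x))"

definition normal_deriv :: "'a::euclidean_space set \<Rightarrow> ('a \<Rightarrow> real) \<Rightarrow> 'a \<Rightarrow> real" where
  "normal_deriv \<Omega> u = (SOME d. is_normal_deriv \<Omega> u d)"

text \<open>That the normal derivative maps \<^const>\<open>H0Delta\<close> into \<^const>\<open>L2\<close> of the boundary is part of the
  condition; compactness is expressed sequentially.\<close>

definition B2 :: "'a::euclidean_space set \<Rightarrow> bool" where
  "B2 \<Omega> \<longleftrightarrow> B1 \<Omega> \<and>
    (\<forall>u\<in>H0Delta \<Omega>. \<exists>d. is_normal_deriv \<Omega> u d) \<and>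
    (\<forall>u :: nat \<Rightarrow> 'a \<Rightarrow> real. (\<forall>n. u n \<in> H0Delta \<Omega>) \<and> (\<exists>C. \<forall>n. norm_Delta \<Omega> (u n) \<le> C) \<longrightarrow>
      (\<exists>r d. strict_mono r \<and> d \<in> L2 (surface_measure \<Omega>) \<and>
        (\<lambda>n. L2_norm (surface_measure \<Omega>) (\<lambda>z. normal_deriv \<Omega> (u (r n)) z - d z)) \<longlonglongrightarrow> 0))"

definition DBS_eigenpair :: "'a::euclidean_space set \<Rightarrow> real \<Rightarrow> ('a \<Rightarrow> real) \<Rightarrow> bool" where
  "DBS_eigenpair \<Omega> q b \<longleftrightarrow> b \<in> H0Delta \<Omega> \<and> \<not> (AE x in lebesgue_on \<Omega>. b x = 0) \<and>
    (\<forall>v\<in>H0Delta \<Omega>. inner_Delta \<Omega> b v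
      = q * (LINT z|surface_measure \<Omega>. normal_deriv \<Omega> b z * normal_deriv \<Omega> v z))"

definition bdry_energy :: "'a::euclidean_space set \<Rightarrow> ('a \<Rightarrow> real) \<Rightarrow> real" where
  "bdry_energy \<Omega> u = (LINT z|surface_measure \<Omega>. \<bar>normal_deriv \<Omega> u z\<bar>\<^sup>2)"

text \<open>Sequences are indexed from 1; their values at index 0 play no role.\<close>

definition admissible ::
    "'a::euclidean_space set \<Rightarrow> (nat \<Rightarrow> 'a \<Rightarrow> real) \<Rightarrow> nat \<Rightarrow> ('a \<Rightarrow> real) set" where
  "admissible \<Omega> b k = {u \<in> H0Delta \<Omega>. norm_Delta \<Omega> u \<le> 1 \<and> (\<forall>j\<in>{1..<k}. inner_Delta \<Omega> u (b j) = 0)}"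

definition DBS_constructed ::
    "'a::euclidean_space set \<Rightarrow> (nat \<Rightarrow> 'a \<Rightarrow> real) \<Rightarrow> (nat \<Rightarrow> real) \<Rightarrow> bool" where
  "DBS_constructed \<Omega> b q \<longleftrightarrow> (\<forall>k\<ge>1. b k \<in> admissible \<Omega> b k \<and>
    (\<forall>u\<in>admissible \<Omega> b k. bdry_energy \<Omega> u \<le> bdry_energy \<Omega> (b k)) \<and>
    q k = 1 / (SUP u\<in>admissible \<Omega> b k. bdry_energy \<Omega> u))"

definition Delta_orthonormal :: "'a::euclidean_space set \<Rightarrow> (nat \<Rightarrow> 'a \<Rightarrow> real) \<Rightarrow> bool" where
  "Delta_orthonormal \<Omega> b \<longleftrightarrow> (\<forall>j\<ge>1. b j \<in> H0Delta \<Omega>) \<and>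
    (\<forall>j\<ge>1. \<forall>k\<ge>1. inner_Delta \<Omega> (b j) (b k) = (if j = k then 1 else 0))"

definition dbs_h :: "'a::euclidean_space set \<Rightarrow> (nat \<Rightarrow> 'a \<Rightarrow> real) \<Rightarrow> nat \<Rightarrow> 'a \<Rightarrow> real" where
  "dbs_h \<Omega> b j = weak_laplacian \<Omega> (b j)"

definition dbs_w ::
    "'a::euclidean_space set \<Rightarrow> (nat \<Rightarrow> 'a \<Rightarrow> real) \<Rightarrow> (nat \<Rightarrow> real) \<Rightarrow> nat \<Rightarrow> 'a \<Rightarrow> real" where
  "dbs_w \<Omega> b q j z = sqrt (q j * surface_area \<Omega>) * normal_deriv \<Omega> (b j) z"

definition dbs_coeff ::
    "'a::euclidean_space set \<Rightarrow> (nat \<Rightarrow> 'a \<Rightarrow> real) \<Rightarrow> (nat \<Rightarrow> real) \<Rightarrow> ('a \<Rightarrow> real) \<Rightarrow> nat \<Rightarrow> real" where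
  "dbs_coeff \<Omega> b q g j = bdry_inner \<Omega> g (dbs_w \<Omega> b q j)"

text \<open>The infinite series is a limit in the Hilbert space \<^const>\<open>L2H\<close>, with the norm of
  \<^const>\<open>L2\<close>; it is determined up to null sets.\<close>

definition harmonic_extension ::
    "'a::euclidean_space set \<Rightarrow> (nat \<Rightarrow> 'a \<Rightarrow> real) \<Rightarrow> (nat \<Rightarrow> real) \<Rightarrow> ('a \<Rightarrow> real) \<Rightarrow> 'a \<Rightarrow> real" where
  "harmonic_extension \<Omega> b q g = (SOME f. f \<in> L2H \<Omega> \<and>
    (\<lambda>n. L2_norm (lebesgue_on \<Omega>) (\<lambda>x. f x -
        sqrt (surface_area \<Omega>) * (\<Sum>j=1..n. dbs_coeff \<Omega> b q g j / sqrt (q j) * dbs_h \<Omega> b j x)))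
      \<longlonglongrightarrow> 0)"

definition poisson_approx ::
    "'a::euclidean_space set \<Rightarrow> (nat \<Rightarrow> 'a \<Rightarrow> real) \<Rightarrow> (nat \<Rightarrow> real) \<Rightarrow> nat \<Rightarrow> 'a \<Rightarrow> 'a \<Rightarrow> real" where
  "poisson_approx \<Omega> b q M x z =
    (\<Sum>j=1..M. dbs_h \<Omega> b j x / sqrt (surface_area \<Omega> * q j) * dbs_w \<Omega> b q j z)"

definition extension_approx ::
    "'a::euclidean_space set \<Rightarrow> (nat \<Rightarrow> 'a \<Rightarrow> real) \<Rightarrow> (nat \<Rightarrow> real) \<Rightarrow> nat \<Rightarrow> ('a \<Rightarrow> real) \<Rightarrow> 'a \<Rightarrow> real" where
  "extension_approx \<Omega> b q M g x = (LINT z|surface_measure \<Omega>. poisson_approx \<Omega> b q M x z * g z)"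

definition bdry_approx ::
    "'a::euclidean_space set \<Rightarrow> (nat \<Rightarrow> 'a \<Rightarrow> real) \<Rightarrow> (nat \<Rightarrow> real) \<Rightarrow> nat \<Rightarrow> ('a \<Rightarrow> real) \<Rightarrow> 'a \<Rightarrow> real" where
  "bdry_approx \<Omega> b q M g z = (\<Sum>j=1..M. dbs_coeff \<Omega> b q g j * dbs_w \<Omega> b q j z)"

end

theory Submission
  imports Defs
begin

text \<open>Write \<open>u\<^sub>j\<close> for \<open>sqrt (q j)\<close> times the normal derivative of \<open>b j\<close> and \<open>h\<^sub>j\<close> for the Laplacian of
  \<open>b j\<close>.  The eigenvalue equation, tested with \<open>b k\<close>, turns the \<open>\<Delta>\<close>-orthonormality of the
  eigenfunctions into two facts: the \<open>h\<^sub>j\<close> are orthonormal in \<open>L2\<close> of the region, and the \<open>u\<^sub>j\<close> are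
  orthonormal in \<open>L2\<close> of the boundary.  With \<open>c\<^sub>j\<close> the integral of \<open>g u\<^sub>j\<close> over the boundary, the factors
  \<open>sqrt |\<partial>\<Omega>|\<close> cancel, and
    \<open>E\<^sub>H g = \<Sum>j. c\<^sub>j / sqrt q\<^sub>j h\<^sub>j\<close>,  \<open>E\<^sub>M g\<close> is its \<open>M\<close>-th partial sum,  \<open>g\<^sub>M = \<Sum>j\<le>M. c\<^sub>j u\<^sub>j\<close>.
  By Pythagoras the squared error is \<open>\<Sum>j>M. c\<^sub>j\<^sup>2 / q\<^sub>j\<close>.  Since \<open>q\<close> increases, this is at most
  \<open>1 / q\<^sub>M\<^sub>+\<^sub>1\<close> times \<open>\<Sum>j>M. c\<^sub>j\<^sup>2\<close>, which Bessel's inequality bounds by the squared norm of \<open>g - g\<^sub>M\<close>.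
  This is \<open>L2_orthonormal_tail_estimate\<close>.

  The harmonic extension is chosen among the members of \<^const>\<open>L2H\<close> to which the series converges, so
  such a member has to exist.  Convergence is the completeness of \<open>L2\<close> (\<open>L2_complete\<close>).  That
  the limit lies in \<^const>\<open>L2H\<close> reduces, by \<open>L2H_closed\<close>, to the orthogonality of each \<open>h\<^sub>j\<close> to the
  Laplacian of every test function \<open>v\<close>.  The eigenvalue equation, tested with \<open>v\<close>, expresses the integral
  of \<open>h\<^sub>j \<Delta>v\<close> through the normal derivative of \<open>v\<close>, which vanishes (\<open>normal_deriv_Cc2\<close>).

  Gradient, Laplacian and normal derivative are arbitrary choices among the functions satisfying an
  integral identity, so identifying them for a test function needs uniqueness almost everywhere.  All
  three cases rest on one fundamental lemma for Borel measures,
  \<open>AE_eq_0_if_orthogonal_to_test_functions\<close>, applied to Lebesgue measure on the region and to surface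
  measure on the boundary.\<close>

section \<open>Square-integrable functions and orthonormal systems\<close>

lemma L2_mult_integrable:
  assumes "f \<in> L2 M" "g \<in> L2 M"
  shows "integrable M (\<lambda>x. f x * g x)"
proof (rule Bochner_Integration.integrable_bound[of M "\<lambda>x. (f x)\<^sup>2 + (g x)\<^sup>2"])
  show "AE x in M. norm (f x * g x) \<le> norm ((f x)\<^sup>2 + (g x)\<^sup>2)"
  proof (intro always_eventually allI)
    fix x
    have "2 * (\<bar>f x\<bar> * \<bar>g x\<bar>) \<le> (f x)\<^sup>2 + (g x)\<^sup>2"
      using sum_squares_bound[of "\<bar>f x\<bar>" "\<bar>g x\<bar>"] by simp
    moreover have "0 \<le> \<bar>f x\<bar> * \<bar>g x\<bar>" by simp
    ultimately have "\<bar>f x\<bar> * \<bar>g x\<bar> \<le> (f x)\<^sup>2 + (g x)\<^sup>2" by linarith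
    then show "norm (f x * g x) \<le> norm ((f x)\<^sup>2 + (g x)\<^sup>2)"
      by (simp add: abs_mult)
  qed
qed (use assms in \<open>auto simp: L2_def\<close>)

lemma L2_zero: "(\<lambda>x. 0) \<in> L2 M"
  by (simp add: L2_def)

lemma L2_scale: "f \<in> L2 M \<Longrightarrow> (\<lambda>x. c * f x) \<in> L2 M"
  by (auto simp: L2_def power_mult_distrib)

lemma L2_add: "f \<in> L2 M \<Longrightarrow> g \<in> L2 M \<Longrightarrow> (\<lambda>x. f x + g x) \<in> L2 M"
  using L2_mult_integrable[of f M g] by (auto simp: L2_def power2_sum mult.assoc)

lemma L2_diff: "f \<in> L2 M \<Longrightarrow> g \<in> L2 M \<Longrightarrow> (\<lambda>x. f x - g x) \<in> L2 M"
  using L2_add[OF _ L2_scale[of g M "-1"], of f] by simp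

lemma L2_sum: "(\<And>j. j \<in> J \<Longrightarrow> f j \<in> L2 M) \<Longrightarrow> (\<lambda>x. \<Sum>j\<in>J. f j x) \<in> L2 M"
  by (induction J rule: infinite_finite_induct) (auto intro: L2_zero L2_add)

lemma L2_integrable:
  assumes "f \<in> L2 M" "finite_measure M"
  shows "integrable M f"
proof -
  interpret finite_measure M by fact
  show ?thesis
  proof (rule Bochner_Integration.integrable_bound[of M "\<lambda>x. 1 + (f x)\<^sup>2"])
    show "AE x in M. norm (f x) \<le> norm (1 + (f x)\<^sup>2)"
    proof (intro always_eventually allI)
      fix x
      have "0 \<le> (\<bar>f x\<bar> - 1)\<^sup>2" by simp
      then show "norm (f x) \<le> norm (1 + (f x)\<^sup>2)"
        unfolding power2_diff by simp
    qed
  qed (use assms in \<open>auto simp: L2_def\<close>)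
qed

lemma bounded_L2:
  assumes "finite_measure M" "f \<in> borel_measurable M" "\<And>x. x \<in> space M \<Longrightarrow> \<bar>f x\<bar> \<le> B"
  shows "f \<in> L2 M"
proof -
  interpret finite_measure M by fact
  have "norm ((f x)\<^sup>2) \<le> B\<^sup>2" if "x \<in> space M" for x
    using power_mono[OF assms(3)[OF that], of 2] by simp
  then have "AE x in M. norm ((f x)\<^sup>2) \<le> B\<^sup>2"
    by (rule AE_I2)
  then have "integrable M (\<lambda>x. (f x)\<^sup>2)"
    using assms(2) by (intro integrable_const_bound) auto
  then show ?thesis
    using assms(2) by (simp add: L2_def)
qed

lemma L2_norm_power2: "(L2_norm M u)\<^sup>2 = (LINT x|M. (u x)\<^sup>2)"
  by (simp add: L2_norm_def)

lemma L2_norm_nonneg: "0 \<le> L2_norm M u"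
  by (simp add: L2_norm_def)

lemma integral_power2_linear_comb:
  assumes "f \<in> L2 M" "g \<in> L2 M"
  shows "(LINT x|M. (a * f x + b * g x)\<^sup>2)
    = a\<^sup>2 * (LINT x|M. (f x)\<^sup>2) + 2 * a * b * (LINT x|M. f x * g x) + b\<^sup>2 * (LINT x|M. (g x)\<^sup>2)"
proof -
  have "(\<lambda>x. (a * f x + b * g x)\<^sup>2) = (\<lambda>x. a\<^sup>2 * (f x)\<^sup>2 + (2 * a * b) * (f x * g x) + b\<^sup>2 * (g x)\<^sup>2)"
    by (simp add: power2_sum power_mult_distrib fun_eq_iff)
  moreover have "integrable M (\<lambda>x. (f x)\<^sup>2)" "integrable M (\<lambda>x. (g x)\<^sup>2)"
    "integrable M (\<lambda>x. f x * g x)"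
    using assms L2_mult_integrable by (auto simp: L2_def)
  ultimately show ?thesis by simp
qed

lemma L2_Cauchy_Schwarz:
  assumes f: "f \<in> L2 M" and g: "g \<in> L2 M"
  shows "\<bar>LINT x|M. f x * g x\<bar> \<le> L2_norm M f * L2_norm M g"
proof -
  let ?A = "LINT x|M. (f x)\<^sup>2" and ?B = "LINT x|M. (g x)\<^sup>2" and ?C = "LINT x|M. f x * g x"
  have nn: "0 \<le> ?A" "0 \<le> ?B" by simp_all
  have "?C\<^sup>2 \<le> ?A * ?B"
  proof (cases "?B = 0")
    case True
    then have "AE x in M. (g x)\<^sup>2 = 0"
      using g by (subst (asm) integral_nonneg_eq_0_iff_AE) (auto simp: L2_def)
    then have "AE x in M. f x * g x = 0"
      by eventually_elim simp
    from integral_eq_zero_AE[OF this] nn show ?thesis by simp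
  next
    case False
    \<comment> \<open>this combination is \<open>?B\<close> times the component of \<open>f\<close> orthogonal to \<open>g\<close>\<close>
    have "0 \<le> (LINT x|M. (?B * f x + (- ?C) * g x)\<^sup>2)" by simp
    also have "\<dots> = ?B * (?A * ?B - ?C\<^sup>2)"
      unfolding integral_power2_linear_comb[OF f g] by (simp add: algebra_simps power2_eq_square)
    finally show ?thesis
      using False nn by (simp add: zero_le_mult_iff less_le)
  qed
  then have "\<bar>?C\<bar> \<le> sqrt (?A * ?B)"
    by (rule real_le_rsqrt[of "\<bar>?C\<bar>", unfolded power2_abs])
  then show ?thesis
    by (simp add: L2_norm_def real_sqrt_mult)
qed

lemma L2_norm_triangle:
  assumes f: "f \<in> L2 M" and g: "g \<in> L2 M"
  shows "L2_norm M (\<lambda>x. f x + g x) \<le> L2_norm M f + L2_norm M g"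
proof (rule power2_le_imp_le)
  have "(L2_norm M (\<lambda>x. f x + g x))\<^sup>2 = (L2_norm M f)\<^sup>2 + 2 * (LINT x|M. f x * g x) + (L2_norm M g)\<^sup>2"
    using integral_power2_linear_comb[OF f g, of 1 1] by (simp add: L2_norm_power2)
  also have "\<dots> \<le> (L2_norm M f + L2_norm M g)\<^sup>2"
    using L2_Cauchy_Schwarz[OF f g] by (simp add: power2_sum)
  finally show "(L2_norm M (\<lambda>x. f x + g x))\<^sup>2 \<le> (L2_norm M f + L2_norm M g)\<^sup>2" .
qed (simp add: L2_norm_nonneg)

text \<open>The weights \<open>4 ^ k\<close> leave the integrals of \<open>4 ^ k * (d k)\<^sup>2\<close> summable, so these terms tend to \<open>0\<close>
  pointwise almost everywhere, that is, \<open>d k\<close> is eventually dominated by \<open>(1/2) ^ k\<close>.  Working with squares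
  throughout avoids comparing \<open>L1\<close> and \<open>L2\<close>, so that the measure may be infinite.\<close>

lemma AE_summable_if_rapidly_decaying_L2:
  assumes d: "\<And>k::nat. d k \<in> L2 M" and le: "\<And>k. (LINT x|M. (d k x)\<^sup>2) \<le> (1/8) ^ k"
  shows "AE x in M. summable (\<lambda>k. d k x)"
proof -
  have int: "integrable M (\<lambda>x. (d k x)\<^sup>2)" and [measurable]: "d k \<in> borel_measurable M" for k
    using d by (auto simp: L2_def)
  have "(\<integral>\<^sup>+ x. (\<Sum>k. ennreal (4 ^ k * (d k x)\<^sup>2)) \<partial>M) = (\<Sum>k. \<integral>\<^sup>+ x. ennreal (4 ^ k * (d k x)\<^sup>2) \<partial>M)"
    by (intro nn_integral_suminf) measurable
  also have "\<dots> \<le> (\<Sum>k. ennreal ((1/2) ^ k))"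
  proof (intro suminf_le)
    fix k
    have "(\<integral>\<^sup>+ x. ennreal (4 ^ k * (d k x)\<^sup>2) \<partial>M) = ennreal (4 ^ k * (LINT x|M. (d k x)\<^sup>2))"
      using int by (subst nn_integral_eq_integral) auto
    also have "\<dots> \<le> ennreal (4 ^ k * (1/8) ^ k)"
      using le by (intro ennreal_leI mult_left_mono) auto
    also have "(4::real) ^ k * (1/8) ^ k = (1/2) ^ k"
      by (simp flip: power_mult_distrib)
    finally show "(\<integral>\<^sup>+ x. ennreal (4 ^ k * (d k x)\<^sup>2) \<partial>M) \<le> ennreal ((1/2) ^ k)" .
  qed auto
  also have "\<dots> = ennreal (\<Sum>k. (1/2) ^ k)"
    by (intro suminf_ennreal2) (auto intro: summable_geometric)
  also have "\<dots> < \<infinity>" by simp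
  finally have "AE x in M. (\<Sum>k. ennreal (4 ^ k * (d k x)\<^sup>2)) \<noteq> \<infinity>"
    by (intro nn_integral_PInf_AE) auto
  then show ?thesis
  proof eventually_elim
    case (elim x)
    then have "summable (\<lambda>k. 4 ^ k * (d k x)\<^sup>2)"
      by (intro summable_suminf_not_top) auto
    then have "\<forall>\<^sub>F k in sequentially. 4 ^ k * (d k x)\<^sup>2 < 1"
      by (intro order_tendstoD[OF summable_LIMSEQ_zero]) auto
    then have "\<forall>\<^sub>F k in sequentially. norm (d k x) \<le> (1/2) ^ k"
    proof eventually_elim
      case (elim k)
      have "(2 ^ k * \<bar>d k x\<bar>)\<^sup>2 \<le> 1\<^sup>2"
        using elim by (simp add: power_mult_distrib flip: power_mult) (simp add: power_mult mult.commute[of k])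
      then have "2 ^ k * \<bar>d k x\<bar> \<le> 1"
        by (rule power2_le_imp_le) simp
      then show ?case by (simp add: field_simps power_divide)
    qed
    then show ?case
      by (rule summable_comparison_test_ev) (simp add: summable_geometric)
  qed
qed

text \<open>Riesz--Fischer: a rapidly converging subsequence converges almost everywhere, and Fatou's lemma turns the
  Cauchy bounds into bounds for the distance to its pointwise limit.\<close>

lemma L2_complete:
  assumes S: "\<And>n::nat. S n \<in> L2 M"
    and Cauchy: "\<And>\<epsilon>::real. \<epsilon> > 0 \<Longrightarrow> \<exists>N. \<forall>m\<ge>N. \<forall>n\<ge>N. (LINT x|M. (S m x - S n x)\<^sup>2) \<le> \<epsilon>"
  obtains f where "f \<in> L2 M" "(\<lambda>n. L2_norm M (\<lambda>x. f x - S n x)) \<longlonglongrightarrow> 0"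
proof -
  have meas [measurable]: "S n \<in> borel_measurable M" for n
    using S by (simp add: L2_def)
  have "\<forall>k. \<exists>N. \<forall>m\<ge>N. \<forall>n\<ge>N. (LINT x|M. (S m x - S n x)\<^sup>2) \<le> (1/8) ^ k"
    using Cauchy by simp
  then obtain N where N: "\<And>k m n. m \<ge> N k \<Longrightarrow> n \<ge> N k \<Longrightarrow> (LINT x|M. (S m x - S n x)\<^sup>2) \<le> (1/8) ^ k"
    by metis
  \<comment> \<open>summing makes the indices exceed every earlier threshold\<close>
  define r where "r k = (\<Sum>i\<le>k. N i)" for k
  have rN: "N j \<le> r k" if "j \<le> k" for j k
    unfolding r_def using that by (intro member_le_sum) auto
  have "AE x in M. summable (\<lambda>k. S (r (Suc k)) x - S (r k) x)"
    by (intro AE_summable_if_rapidly_decaying_L2 L2_diff S N rN) auto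
  then have conv: "AE x in M. convergent (\<lambda>k. S (r k) x)"
  proof eventually_elim
    case (elim x)
    then have "convergent (\<lambda>n. S (r n) x - S (r 0) x)"
      by (simp add: summable_iff_convergent sum_lessThan_telescope[of "\<lambda>k. S (r k) x"])
    from convergent_add[OF this convergent_const[of "S (r 0) x"]] show ?case
      by simp
  qed
  define f where "f x = lim (\<lambda>k. S (r k) x)" for x
  have f [measurable]: "f \<in> borel_measurable M"
    unfolding f_def by measurable
  have bound: "integrable M (\<lambda>x. (f x - S n x)\<^sup>2)" "(LINT x|M. (f x - S n x)\<^sup>2) \<le> (1/8) ^ j"
    if n: "n \<ge> N j" for n j
  proof -
    have "(\<integral>\<^sup>+ x. ennreal ((f x - S n x)\<^sup>2) \<partial>M)
        = (\<integral>\<^sup>+ x. liminf (\<lambda>k. ennreal ((S (r k) x - S n x)\<^sup>2)) \<partial>M)"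
    proof (rule nn_integral_cong_AE)
      show "AE x in M. ennreal ((f x - S n x)\<^sup>2) = liminf (\<lambda>k. ennreal ((S (r k) x - S n x)\<^sup>2))"
        using conv
      proof eventually_elim
        case (elim x)
        then have "(\<lambda>k. S (r k) x) \<longlonglongrightarrow> f x"
          by (simp add: f_def convergent_LIMSEQ_iff)
        then have "(\<lambda>k. ennreal ((S (r k) x - S n x)\<^sup>2)) \<longlonglongrightarrow> ennreal ((f x - S n x)\<^sup>2)"
          by (intro tendsto_ennrealI tendsto_intros)
        then show ?case
          by (intro lim_imp_Liminf[symmetric]) auto
      qed
    qed
    also have "\<dots> \<le> liminf (\<lambda>k. \<integral>\<^sup>+ x. ennreal ((S (r k) x - S n x)\<^sup>2) \<partial>M)"
      by (intro nn_integral_liminf) measurable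
    also have "\<dots> \<le> ennreal ((1/8) ^ j)"
    proof (rule Liminf_le[OF trivial_limit_sequentially])
      show "\<forall>\<^sub>F k in sequentially. (\<integral>\<^sup>+ x. ennreal ((S (r k) x - S n x)\<^sup>2) \<partial>M) \<le> ennreal ((1/8) ^ j)"
        using eventually_ge_at_top[of j]
      proof eventually_elim
        case (elim k)
        have "(\<integral>\<^sup>+ x. ennreal ((S (r k) x - S n x)\<^sup>2) \<partial>M) = ennreal (LINT x|M. (S (r k) x - S n x)\<^sup>2)"
          using L2_diff[OF S S, of "r k" n] by (intro nn_integral_eq_integral) (auto simp: L2_def)
        also have "\<dots> \<le> ennreal ((1/8) ^ j)"
          using rN[OF elim] n by (intro ennreal_leI N)
        finally show ?case .
      qed
    qed
    finally have le: "(\<integral>\<^sup>+ x. ennreal ((f x - S n x)\<^sup>2) \<partial>M) \<le> ennreal ((1/8) ^ j)" .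
    then show int: "integrable M (\<lambda>x. (f x - S n x)\<^sup>2)"
      by (intro integrableI_bounded) (auto intro: le_less_trans)
    show "(LINT x|M. (f x - S n x)\<^sup>2) \<le> (1/8) ^ j"
      using le by (subst (asm) nn_integral_eq_integral[OF int]) auto
  qed
  show thesis
  proof
    have "(\<lambda>x. f x - S (N 0) x) \<in> L2 M"
      using bound(1)[of 0 "N 0"] by (simp add: L2_def)
    from L2_add[OF this S[of "N 0"]] show "f \<in> L2 M" by simp
    show "(\<lambda>n. L2_norm M (\<lambda>x. f x - S n x)) \<longlonglongrightarrow> 0"
    proof -
      have "(\<lambda>n. LINT x|M. (f x - S n x)\<^sup>2) \<longlonglongrightarrow> 0"
      proof (rule LIMSEQ_I)
        fix \<epsilon> :: real assume "\<epsilon> > 0"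
        then obtain j where "(1/8::real) ^ j < \<epsilon>"
          using real_arch_pow_inv[of \<epsilon> "1/8"] by auto
        then show "\<exists>n0. \<forall>n\<ge>n0. norm ((LINT x|M. (f x - S n x)\<^sup>2) - 0) < \<epsilon>"
          using bound(2) by (intro exI[of _ "N j"]) (fastforce intro: le_less_trans)
      qed
      from tendsto_real_sqrt[OF this] show ?thesis
        by (simp add: L2_norm_def)
    qed
  qed
qed

definition L2_orthonormal :: "'a measure \<Rightarrow> 'i set \<Rightarrow> ('i \<Rightarrow> 'a \<Rightarrow> real) \<Rightarrow> bool" where
  "L2_orthonormal M J e \<longleftrightarrow> (\<forall>j\<in>J. e j \<in> L2 M) \<and>
    (\<forall>j\<in>J. \<forall>k\<in>J. (LINT x|M. e j x * e k x) = (if j = k then 1 else 0))"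

lemma L2_orthonormal_subset: "L2_orthonormal M J e \<Longrightarrow> I \<subseteq> J \<Longrightarrow> L2_orthonormal M I e"
  unfolding L2_orthonormal_def by blast

lemma L2_orthonormal_sum_L2: "L2_orthonormal M J e \<Longrightarrow> (\<lambda>x. \<Sum>j\<in>J. c j * e j x) \<in> L2 M"
  unfolding L2_orthonormal_def by (intro L2_sum L2_scale) blast

lemma integral_sum_mult:
  assumes "\<And>j. j \<in> J \<Longrightarrow> e j \<in> L2 M" "g \<in> L2 M"
  shows "(LINT x|M. (\<Sum>j\<in>J. c j * e j x) * g x) = (\<Sum>j\<in>J. c j * (LINT x|M. e j x * g x))"
  using assms by (simp add: sum_distrib_right mult.assoc Bochner_Integration.integral_sum L2_mult_integrable)

lemma L2_orthonormal_Pythagoras: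
  assumes "finite J" and e: "L2_orthonormal M J e"
  shows "(LINT x|M. (\<Sum>j\<in>J. c j * e j x)\<^sup>2) = (\<Sum>j\<in>J. (c j)\<^sup>2)"
proof -
  let ?s = "\<lambda>x. \<Sum>j\<in>J. c j * e j x"
  have eL: "e j \<in> L2 M" if "j \<in> J" for j
    using e that by (simp add: L2_orthonormal_def)
  have inner: "(LINT x|M. e j x * ?s x) = c j" if j: "j \<in> J" for j
  proof -
    have "(LINT x|M. e j x * ?s x) = (LINT x|M. ?s x * e j x)"
      by (simp add: mult.commute)
    also have "\<dots> = (\<Sum>k\<in>J. c k * (LINT x|M. e k x * e j x))"
      using eL j by (intro integral_sum_mult) auto
    also have "\<dots> = (\<Sum>k\<in>J. if k = j then c k else 0)"
      using e j by (intro sum.cong) (auto simp: L2_orthonormal_def)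
    also have "\<dots> = c j" using assms(1) j by simp
    finally show ?thesis .
  qed
  have "(LINT x|M. (?s x)\<^sup>2) = (LINT x|M. ?s x * ?s x)"
    by (simp add: power2_eq_square)
  also have "\<dots> = (\<Sum>j\<in>J. c j * (LINT x|M. e j x * ?s x))"
    using eL L2_orthonormal_sum_L2[OF e] by (intro integral_sum_mult) auto
  also have "\<dots> = (\<Sum>j\<in>J. (c j)\<^sup>2)"
    by (simp add: inner power2_eq_square)
  finally show ?thesis .
qed

text \<open>The coefficients are those of the orthogonal projection, so the mixed term cancels one of the two sums
  of squares.\<close>

lemma L2_orthonormal_residual:
  assumes J: "finite J" and e: "L2_orthonormal M J e" and g: "g \<in> L2 M"
    and c: "\<And>j. j \<in> J \<Longrightarrow> c j = (LINT x|M. g x * e j x)"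
  shows "(LINT x|M. (g x - (\<Sum>j\<in>J. c j * e j x))\<^sup>2) = (LINT x|M. (g x)\<^sup>2) - (\<Sum>j\<in>J. (c j)\<^sup>2)"
proof -
  let ?s = "\<lambda>x. \<Sum>j\<in>J. c j * e j x"
  have s: "?s \<in> L2 M" using e by (rule L2_orthonormal_sum_L2)
  have "(LINT x|M. ?s x * g x) = (\<Sum>j\<in>J. c j * (LINT x|M. e j x * g x))"
    using e g by (intro integral_sum_mult) (auto simp: L2_orthonormal_def)
  also have "\<dots> = (\<Sum>j\<in>J. (c j)\<^sup>2)"
    using c by (intro sum.cong) (auto simp: power2_eq_square mult.commute)
  finally have "(LINT x|M. g x * ?s x) = (\<Sum>j\<in>J. (c j)\<^sup>2)"
    by (simp add: mult.commute)
  then show ?thesis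
    using integral_power2_linear_comb[OF g s, of 1 "-1"] L2_orthonormal_Pythagoras[OF J e, of c]
    by simp
qed

lemma L2_Bessel:
  assumes "finite J" "L2_orthonormal M J e" "g \<in> L2 M"
  shows "(\<Sum>j\<in>J. (LINT x|M. g x * e j x)\<^sup>2) \<le> (LINT x|M. (g x)\<^sup>2)"
proof -
  have "0 \<le> (LINT x|M. (g x - (\<Sum>j\<in>J. (LINT x|M. g x * e j x) * e j x))\<^sup>2)" by simp
  then show ?thesis
    using L2_orthonormal_residual[OF assms, of "\<lambda>j. LINT x|M. g x * e j x"] by simp
qed

lemma sum_Icc_split:
  fixes F :: "nat \<Rightarrow> real"
  assumes "m \<le> n"
  shows "(\<Sum>j=1..n. F j) = (\<Sum>j=1..m. F j) + (\<Sum>j\<in>{m<..n}. F j)"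
proof -
  have "{1..n} = {1..m} \<union> {m<..n}" "{1..m} \<inter> {m<..n} = {}"
    using assms by auto
  then show ?thesis
    by (metis finite_atLeastAtMost finite_greaterThanAtMost sum.union_disjoint)
qed

lemma L2_orthonormal_partial_sum_diff:
  fixes a :: "nat \<Rightarrow> real"
  assumes e: "L2_orthonormal M {1..} e" and mn: "m \<le> n"
  shows "(LINT x|M. ((\<Sum>j=1..n. a j * e j x) - (\<Sum>j=1..m. a j * e j x))\<^sup>2) = (\<Sum>j\<in>{m<..n}. (a j)\<^sup>2)"
proof -
  have split: "(\<Sum>j=1..n. F j) - (\<Sum>j=1..m. F j) = (\<Sum>j\<in>{m<..n}. F j)" for F :: "nat \<Rightarrow> real"
    using sum_Icc_split[OF mn, of F] by simp
  show ?thesis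
    unfolding split by (rule L2_orthonormal_Pythagoras[OF _ L2_orthonormal_subset[OF e]]) auto
qed

lemma L2_orthonormal_series_converges:
  fixes a :: "nat \<Rightarrow> real"
  assumes e: "L2_orthonormal M {1..} e" and B: "\<And>n. (\<Sum>j=1..n. (a j)\<^sup>2) \<le> B"
  obtains f where "f \<in> L2 M" "(\<lambda>n. L2_norm M (\<lambda>x. f x - (\<Sum>j=1..n. a j * e j x))) \<longlonglongrightarrow> 0"
proof (rule L2_complete[of "\<lambda>n x. \<Sum>j=1..n. a j * e j x" M])
  let ?S = "\<lambda>n x. \<Sum>j=1..n. a j * e j x" and ?P = "\<lambda>n. \<Sum>j=1..n. (a j)\<^sup>2"
  show "?S n \<in> L2 M" for n
    by (rule L2_orthonormal_sum_L2[OF L2_orthonormal_subset[OF e]]) auto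
  have diff: "(LINT x|M. (?S m x - ?S n x)\<^sup>2) = \<bar>?P m - ?P n\<bar>" for m n
  proof (induction m n rule: linorder_wlog)
    case (le m n)
    have "?P n = ?P m + (\<Sum>j\<in>{m<..n}. (a j)\<^sup>2)"
      using sum_Icc_split[OF le] .
    moreover have "0 \<le> (\<Sum>j\<in>{m<..n}. (a j)\<^sup>2)" by (intro sum_nonneg) simp
    ultimately show ?case
      using L2_orthonormal_partial_sum_diff[OF e le, of a] by (simp add: power2_commute)
  next
    case (sym m n)
    then show ?case by (simp add: power2_commute abs_minus_commute)
  qed
  have "incseq ?P"
    by (intro incseq_SucI) simp
  then have "convergent ?P"
    using B by (meson convergent_def incseq_convergent)
  then have "Cauchy ?P" by (rule convergent_Cauchy)
  then have "\<exists>N. \<forall>m\<ge>N. \<forall>n\<ge>N. \<bar>?P m - ?P n\<bar> < \<epsilon>" if "\<epsilon> > 0" for \<epsilon>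
    using that by (simp add: Cauchy_def dist_real_def)
  then show "\<exists>N. \<forall>m\<ge>N. \<forall>n\<ge>N. (LINT x|M. (?S m x - ?S n x)\<^sup>2) \<le> \<epsilon>" if "\<epsilon> > 0" for \<epsilon>
    unfolding diff using that less_imp_le by metis
qed (rule that)

text \<open>The abstract form of the error bound.  Increasing weights \<open>q\<close> make the map sending \<open>u j\<close> to
  \<open>h j / sqrt (q j)\<close> scale the norm of the part of \<open>g\<close> beyond the first \<open>m\<close> modes by at most
  \<open>1 / sqrt (q (m + 1))\<close>.  The estimate is proved for finite tails and passes to the limit with the triangle
  inequality.\<close>

lemma L2_orthonormal_tail_estimate:
  fixes q :: "nat \<Rightarrow> real"
  assumes h: "L2_orthonormal M {1..} h" and u: "L2_orthonormal N {1..} u" and g: "g \<in> L2 N"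
    and c: "\<And>j. c j = (LINT z|N. g z * u j z)"
    and q: "\<And>j. j \<ge> 1 \<Longrightarrow> 0 < q j" "\<And>j k. 1 \<le> j \<Longrightarrow> j \<le> k \<Longrightarrow> q j \<le> q k"
    and f: "f \<in> L2 M"
    and lim: "(\<lambda>n. L2_norm M (\<lambda>x. f x - (\<Sum>j=1..n. c j / sqrt (q j) * h j x))) \<longlonglongrightarrow> 0"
  shows "L2_norm M (\<lambda>x. f x - (\<Sum>j=1..m. c j / sqrt (q j) * h j x))
    \<le> sqrt ((LINT z|N. (g z - (\<Sum>j=1..m. c j * u j z))\<^sup>2) / q (m + 1))"
proof -
  let ?S = "\<lambda>n x. \<Sum>j=1..n. c j / sqrt (q j) * h j x"
  let ?R = "LINT z|N. (g z - (\<Sum>j=1..m. c j * u j z))\<^sup>2"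
  have SL: "?S n \<in> L2 M" for n
    by (rule L2_orthonormal_sum_L2[OF L2_orthonormal_subset[OF h]]) auto
  have tail: "L2_norm M (\<lambda>x. ?S n x - ?S m x) \<le> sqrt (?R / q (m + 1))" if "m \<le> n" for n
  proof -
    have "(\<Sum>j=1..n. (c j)\<^sup>2) \<le> (LINT z|N. (g z)\<^sup>2)"
      unfolding c using L2_orthonormal_subset[OF u] by (intro L2_Bessel g) auto
    moreover have "?R = (LINT z|N. (g z)\<^sup>2) - (\<Sum>j=1..m. (c j)\<^sup>2)"
      using L2_orthonormal_subset[OF u] by (intro L2_orthonormal_residual g c) auto
    ultimately have tail_c: "(\<Sum>j\<in>{m<..n}. (c j)\<^sup>2) \<le> ?R"
      using sum_Icc_split[OF that, of "\<lambda>j. (c j)\<^sup>2"] by simp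
    have "(LINT x|M. (?S n x - ?S m x)\<^sup>2) = (\<Sum>j\<in>{m<..n}. (c j / sqrt (q j))\<^sup>2)"
      by (rule L2_orthonormal_partial_sum_diff[OF h that])
    also have "\<dots> \<le> (\<Sum>j\<in>{m<..n}. (c j)\<^sup>2 / q (m + 1))"
    proof (rule sum_mono)
      fix j assume j: "j \<in> {m<..n}"
      then have "0 < q j" "q (m + 1) \<le> q j" "0 < q (m + 1)"
        using q by auto
      then show "(c j / sqrt (q j))\<^sup>2 \<le> (c j)\<^sup>2 / q (m + 1)"
        by (simp add: power_divide frac_le)
    qed
    also have "\<dots> \<le> ?R / q (m + 1)"
      using tail_c q(1)[of "m + 1"] by (simp add: sum_divide_distrib[symmetric] divide_right_mono)
    finally show ?thesis
      unfolding L2_norm_def by (rule real_sqrt_le_mono)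
  qed
  have "L2_norm M (\<lambda>x. f x - ?S m x) \<le> L2_norm M (\<lambda>x. f x - ?S n x) + sqrt (?R / q (m + 1))"
    if "n \<ge> m" for n
    using L2_norm_triangle[OF L2_diff[OF f SL[of n]] L2_diff[OF SL[of n] SL[of m]]] tail[OF that] by simp
  then have "\<exists>n0. \<forall>n\<ge>n0. L2_norm M (\<lambda>x. f x - ?S m x) \<le> L2_norm M (\<lambda>x. f x - ?S n x) + sqrt (?R / q (m + 1))"
    by blast
  moreover have "(\<lambda>n. L2_norm M (\<lambda>x. f x - ?S n x) + sqrt (?R / q (m + 1))) \<longlonglongrightarrow> sqrt (?R / q (m + 1))"
    using tendsto_add[OF lim tendsto_const, of "sqrt (?R / q (m + 1))"] by simp
  ultimately show ?thesis
    by (rule LIMSEQ_le_const[rotated])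
qed

section \<open>Functions of class \<open>C1\<close> and \<open>C2\<close>\<close>

lemma pd_eq:
  assumes "(f has_derivative f') (at x)"
  shows "pd i f x = f' i"
  using frechet_derivative_at[OF assms] by (simp add: pd_def)

lemma C1I:
  assumes "\<And>x. (f has_derivative f' x) (at x)"
    and "\<And>i. i \<in> Basis \<Longrightarrow> continuous_on UNIV (\<lambda>x. f' x i)"
  shows "f \<in> C1"
proof -
  have "pd i f = (\<lambda>x. f' x i)" for i
    using pd_eq[OF assms(1)] by blast
  then show ?thesis
    using assms by (auto simp: C1_def differentiable_def)
qed

lemma C1_has_derivative:
  assumes "f \<in> C1"
  shows "(f has_derivative (\<lambda>h. pd h f x)) (at x)"
  using assms by (auto simp: C1_def pd_def frechet_derivative_works)

lemma C1_continuous_pd: "f \<in> C1 \<Longrightarrow> i \<in> Basis \<Longrightarrow> continuous_on UNIV (pd i f)"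
  by (simp add: C1_def)

lemma C1_continuous: "f \<in> C1 \<Longrightarrow> continuous_on UNIV f"
  by (auto simp: C1_def intro!: differentiable_imp_continuous_on differentiable_at_imp_differentiable_on)

lemma pd_const: "pd i (\<lambda>x. c) = (\<lambda>x. 0)"
  by (intro ext pd_eq) (auto intro!: derivative_eq_intros)

lemma C1_const: "(\<lambda>x. c) \<in> C1"
  by (rule C1I[where f' = "\<lambda>x h. 0"]) auto

lemma pd_add: "f \<in> C1 \<Longrightarrow> g \<in> C1 \<Longrightarrow> pd i (\<lambda>x. f x + g x) = (\<lambda>x. pd i f x + pd i g x)"
  using has_derivative_add[OF C1_has_derivative C1_has_derivative] by (intro ext pd_eq)

lemma C1_add: "f \<in> C1 \<Longrightarrow> g \<in> C1 \<Longrightarrow> (\<lambda>x. f x + g x) \<in> C1"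
  by (rule C1I[OF has_derivative_add[OF C1_has_derivative C1_has_derivative]])
    (auto intro!: continuous_intros C1_continuous_pd)

lemma pd_mult:
  assumes "f \<in> C1" "g \<in> C1"
  shows "pd i (\<lambda>x. f x * g x) = (\<lambda>x. f x * pd i g x + pd i f x * g x)"
  using has_derivative_mult[OF C1_has_derivative C1_has_derivative, OF assms]
  by (intro ext pd_eq)

lemma C1_mult: "f \<in> C1 \<Longrightarrow> g \<in> C1 \<Longrightarrow> (\<lambda>x. f x * g x) \<in> C1"
  by (rule C1I[OF has_derivative_mult[OF C1_has_derivative C1_has_derivative]])
    (auto intro!: continuous_on_add continuous_on_mult simp: C1_continuous_pd C1_continuous)

lemma
  fixes f :: "'a::euclidean_space \<Rightarrow> real"
  assumes r: "\<And>t. (\<rho> has_real_derivative \<rho>' t) (at t)" and c: "continuous_on UNIV \<rho>'"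
    and f: "f \<in> C1"
  shows pd_compose: "pd i (\<lambda>x. \<rho> (f x)) = (\<lambda>x. \<rho>' (f x) * pd i f x)"
    and C1_compose: "(\<lambda>x. \<rho> (f x)) \<in> C1"
proof -
  have d: "((\<lambda>x. \<rho> (f x)) has_derivative (\<lambda>h. \<rho>' (f x) * pd h f x)) (at x)" for x
    using has_derivative_compose[OF C1_has_derivative[OF f, of x] r[of "f x", unfolded has_field_derivative_def]]
    by simp
  show "pd i (\<lambda>x. \<rho> (f x)) = (\<lambda>x. \<rho>' (f x) * pd i f x)"
    by (intro ext pd_eq d)
  show "(\<lambda>x. \<rho> (f x)) \<in> C1"
    by (rule C1I[OF d])
      (auto intro!: continuous_intros C1_continuous_pd[OF f] C1_continuous[OF f]
        continuous_on_compose2[OF c])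
qed

lemma C2_imp_C1: "f \<in> C2 \<Longrightarrow> f \<in> C1"
  by (simp add: C2_def)

lemma C2_pd: "f \<in> C2 \<Longrightarrow> i \<in> Basis \<Longrightarrow> pd i f \<in> C1"
  by (simp add: C2_def)

lemma C2_const: "(\<lambda>x. c) \<in> C2"
  by (simp add: C2_def C1_const pd_const)

lemma C2_add: "f \<in> C2 \<Longrightarrow> g \<in> C2 \<Longrightarrow> (\<lambda>x. f x + g x) \<in> C2"
  by (simp add: C2_def C1_add pd_add)

lemma C2_mult: "f \<in> C2 \<Longrightarrow> g \<in> C2 \<Longrightarrow> (\<lambda>x. f x * g x) \<in> C2"
  by (simp add: C2_def C1_mult C1_add pd_mult)

lemma C2_diff: "f \<in> C2 \<Longrightarrow> g \<in> C2 \<Longrightarrow> (\<lambda>x. f x - g x) \<in> C2"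
  using C2_add[OF _ C2_mult[OF C2_const[of "-1"]], of f g] by simp

lemma C2_power: "f \<in> C2 \<Longrightarrow> (\<lambda>x. f x ^ n) \<in> C2"
  by (induction n) (auto intro: C2_const C2_mult)

lemma C2_prod: "(\<And>k. k \<in> I \<Longrightarrow> f k \<in> C2) \<Longrightarrow> (\<lambda>x. \<Prod>k\<in>I. f k x) \<in> C2"
  by (induction I rule: infinite_finite_induct) (auto intro: C2_const C2_mult)

lemma DERIV_positive_part_power:
  fixes t :: real
  assumes "k \<ge> 1"
  shows "((\<lambda>t. max 0 t ^ Suc k) has_real_derivative real (Suc k) * max 0 t ^ k) (at t)"
proof -
  consider "t < 0" | "t = 0" | "t > 0" by linarith
  then show ?thesis
  proof cases
    case 1
    have "((\<lambda>t::real. 0) has_real_derivative 0) (at t)" by simp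
    then have "((\<lambda>t. max 0 t ^ Suc k) has_real_derivative 0) (at t)"
      by (rule has_field_derivative_transform_within_open[of _ _ _ "{..<0}"]) (use 1 in auto)
    moreover have "real (Suc k) * max 0 t ^ k = 0" using 1 assms by (simp add: zero_power)
    ultimately show ?thesis by (simp only:)
  next
    case 3
    have "((\<lambda>t. t ^ Suc k) has_real_derivative real (Suc k) * t ^ k) (at t)"
      using DERIV_pow[of "Suc k" t] by simp
    then have "((\<lambda>t. max 0 t ^ Suc k) has_real_derivative real (Suc k) * t ^ k) (at t)"
      by (rule has_field_derivative_transform_within_open[of _ _ _ "{0<..}"]) (use 3 in auto)
    then show ?thesis using 3 by simp
  next
    case 2
    have "((\<lambda>h::real. max 0 h ^ Suc k / h) \<longlongrightarrow> 0) (at 0)"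
    proof (rule Lim_null_comparison)
      show "\<forall>\<^sub>F h::real in at 0. norm (max 0 h ^ Suc k / h) \<le> \<bar>h\<bar> ^ k"
        by (rule always_eventually) (auto simp: max_def abs_mult power_abs)
      show "((\<lambda>h::real. \<bar>h\<bar> ^ k) \<longlongrightarrow> 0) (at 0)"
        using assms by (auto intro!: tendsto_eq_intros)
    qed
    then show ?thesis
      using 2 assms by (simp add: DERIV_def zero_power)
  qed
qed

text \<open>The cube is the lowest power for which cutting off at \<open>0\<close> keeps two continuous derivatives.\<close>

lemma C2_positive_part_cube:
  assumes f: "f \<in> C2"
  shows "(\<lambda>x. max 0 (f x) ^ 3) \<in> C2"
proof -
  have d3: "((\<lambda>t::real. max 0 t ^ 3) has_real_derivative 3 * max 0 t ^ 2) (at t)" for t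
    using DERIV_positive_part_power[of 2 t] by (simp add: eval_nat_numeral)
  have d2: "((\<lambda>t::real. 3 * max 0 t ^ 2) has_real_derivative 6 * max 0 t) (at t)" for t
    using DERIV_cmult[OF DERIV_positive_part_power[of 1 t], of 3] by (simp add: eval_nat_numeral)
  have c3: "continuous_on UNIV (\<lambda>t::real. 3 * max 0 t ^ 2)"
    and c2: "continuous_on UNIV (\<lambda>t::real. 6 * max 0 t)"
    by (intro continuous_intros)+
  show ?thesis
    unfolding C2_def using f
    by (auto simp: pd_compose[OF d3 c3 C2_imp_C1[OF f]] C2_def
        intro!: C1_compose[OF d3 c3] C1_mult C1_compose[OF d2 c2])
qed

lemma C2_dist_sq: "(\<lambda>x. (x - p) \<bullet> (x - p)) \<in> C2"
proof -
  have d: "((\<lambda>x. (x - p) \<bullet> (x - p)) has_derivative (\<lambda>h. 2 * ((x - p) \<bullet> h))) (at x)" for x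
    by (auto intro!: derivative_eq_intros simp: inner_commute)
  have pd: "pd i (\<lambda>x. (x - p) \<bullet> (x - p)) = (\<lambda>x. 2 * ((x - p) \<bullet> i))" for i
    by (intro ext pd_eq d)
  have "(\<lambda>x. 2 * ((x - p) \<bullet> i)) \<in> C1" for i
    by (rule C1I[where f' = "\<lambda>x h. 2 * (h \<bullet> i)"])
      (auto intro!: derivative_eq_intros continuous_intros)
  moreover have "(\<lambda>x. (x - p) \<bullet> (x - p)) \<in> C1"
    by (rule C1I[OF d]) (auto intro!: continuous_intros)
  ultimately show ?thesis
    by (simp add: C2_def pd)
qed

text \<open>The positivity set has to be the whole ball, not merely contain a smaller one, for the exhaustion of
  open sets below.\<close>

lemma exists_bump:
  fixes p :: "'a::euclidean_space"
  assumes "r > 0"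
  obtains s where "s \<in> C2" "\<And>x. 0 \<le> s x" "\<And>x. s x \<le> 1" "\<And>x. 0 < s x \<longleftrightarrow> x \<in> ball p r"
proof
  let ?u = "\<lambda>x. 1 - (x - p) \<bullet> (x - p) / r\<^sup>2"
  let ?s = "\<lambda>x. max 0 (?u x) ^ 3"
  have "(\<lambda>x. 1 - (1 / r\<^sup>2) * ((x - p) \<bullet> (x - p))) \<in> C2"
    by (intro C2_diff C2_mult C2_const C2_dist_sq)
  then have "?u \<in> C2" by simp
  then show "?s \<in> C2" by (rule C2_positive_part_cube)
  show "0 \<le> ?s x" "?s x \<le> 1" for x
    by (auto intro!: power_le_one)
  have "0 < ?s x \<longleftrightarrow> 0 < ?u x" for x
    by (auto simp: zero_less_power_eq max_def)
  also have "\<dots> x \<longleftrightarrow> (norm (x - p))\<^sup>2 < r\<^sup>2" for x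
    using assms by (simp add: dot_square_norm)
  also have "\<dots> x \<longleftrightarrow> x \<in> ball p r" for x
    using assms power_strict_mono[of "norm (x - p)" r 2] power2_less_imp_less[of "norm (x - p)" r]
    by (auto simp: dist_norm norm_minus_commute)
  finally show "0 < ?s x \<longleftrightarrow> x \<in> ball p r" for x .
qed

section \<open>Test functions separate square-integrable functions\<close>

lemma Int_stable_open: "Int_stable {S. open S}"
  by (auto simp: Int_stable_def)

text \<open>The sets over which \<open>f\<close> integrates to \<open>0\<close> form a Dynkin system; once it contains the open sets it contains
  the Borel set where \<open>f\<close> is positive.\<close>

lemma AE_eq_0_if_integral_open_eq_0:
  fixes f :: "'a::topological_space \<Rightarrow> real"
  assumes M: "sets M = sets borel" and f: "integrable M f"
    and V: "\<And>V. open V \<Longrightarrow> (LINT x|M. indicator V x * f x) = 0"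
  shows "AE x in M. f x = 0"
proof -
  have sp: "space M = UNIV"
    using sets_eq_imp_space_eq[OF M] by simp
  have int: "integrable M (\<lambda>x. indicator A x * f x)" if "A \<in> sets borel" for A
    using integrable_mult_indicator[of A M f] that f M by simp
  have zero: "(LINT x|M. indicator A x * f x) = 0" if "A \<in> sets borel" for A
  proof -
    have sub: "{S :: 'a set. open S} \<subseteq> Pow UNIV"
      by simp
    have "A \<in> sigma_sets UNIV {S. open S}"
      using that by (simp add: borel_def)
    with Int_stable_open sub show ?thesis
    proof (induction rule: sigma_sets_induct_disjoint)
      case (basic A)
      then show ?case using V by simp
    next
      case empty
      then show ?case by simp
    next
      case (compl A)
      have A: "A \<in> sets borel" using compl by (simp add: borel_def)
      have "(LINT x|M. indicator (UNIV - A) x * f x)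
          = (LINT x|M. indicator UNIV x * f x - indicator A x * f x)"
        by (intro Bochner_Integration.integral_cong) (auto simp: indicator_def)
      also have "\<dots> = 0"
        using V[of UNIV] compl int[of UNIV] int[OF A] by simp
      finally show ?case .
    next
      case (union A)
      have A: "A i \<in> sets M" for i using union(2) M by (auto simp: borel_def)
      have "set_lebesgue_integral M (\<Union>i. A i) f = (\<Sum>i. set_lebesgue_integral M (A i) f)"
      proof (rule lebesgue_integral_countable_add[OF A])
        show "A i \<inter> A j = {}" if "i \<noteq> j" for i j
          using union(1) that by (auto simp: disjoint_family_on_def)
        have "(\<Union>i. A i) \<in> sets borel" using A M by auto
        then show "set_integrable M (\<Union>i. A i) f"
          using int by (simp add: set_integrable_def)
      qed
      then show ?case
        using union(3) by (simp add: set_lebesgue_integral_def)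
    qed
  qed
  have pos: "AE x in M. g x \<le> 0"
    if g: "integrable M g" and z: "\<And>A. A \<in> sets borel \<Longrightarrow> (LINT x|M. indicator A x * g x) = 0"
    for g :: "'a \<Rightarrow> real"
  proof -
    have "g \<in> borel_measurable borel"
      using borel_measurable_integrable[OF g] unfolding measurable_cong_sets[OF M refl] .
    then have A: "{x. g x > 0} \<in> sets borel"
      by measurable
    have eq: "indicator {x. g x > 0} x * g x = max 0 (g x)" for x
      by (auto simp: indicator_def max_def)
    have "(LINT x|M. max 0 (g x)) = 0"
      using z[OF A] by (simp add: eq)
    moreover have "integrable M (\<lambda>x. max 0 (g x))"
      using g by (intro integrable_max) auto
    ultimately have "AE x in M. max 0 (g x) = 0"
      by (subst (asm) integral_nonneg_eq_0_iff_AE) auto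
    then show ?thesis by eventually_elim (simp add: max_def split: if_splits)
  qed
  have "AE x in M. f x \<le> 0" "AE x in M. - f x \<le> 0"
    using pos[OF f zero] pos[of "\<lambda>x. - f x"] f zero by auto
  then show ?thesis by eventually_elim simp
qed

lemma Cc2_C2: "\<phi> \<in> Cc2 U \<Longrightarrow> \<phi> \<in> C2"
  by (simp add: Cc2_def)

lemma Cc2_imp_Cc1: "\<phi> \<in> Cc2 U \<Longrightarrow> \<phi> \<in> Cc1 U"
  by (simp add: Cc2_def Cc1_def C2_def)

lemma compact_supp_mono: "U \<subseteq> V \<Longrightarrow> \<phi> \<in> compact_supp U \<Longrightarrow> \<phi> \<in> compact_supp V"
  unfolding compact_supp_def by blast

text \<open>Cover \<open>W\<close> by countably many balls \<open>e i\<close> with bump functions \<open>s i\<close> that are positive exactly on \<open>e i\<close>.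
  Then \<open>1 - (\<Prod>i<n. (1 - s i) ^ n)\<close> is a polynomial in finitely many bumps without constant term, so it is
  again a test function; it vanishes off \<open>W\<close>, and the powers push it up to \<open>1\<close> at every point of \<open>W\<close>.\<close>

lemma open_exhaustion_by_test_functions:
  fixes W :: "'a::euclidean_space set"
  assumes "open W"
  obtains T where "\<And>n::nat. T n \<in> Cc2 W" "\<And>n x. 0 \<le> T n x" "\<And>n x. T n x \<le> 1"
    "\<And>x. (\<lambda>n. T n x) \<longlonglongrightarrow> indicator W x"
proof -
  obtain B where B: "B \<subseteq> {ball x r | x r. 0 < r \<and> cball x r \<subseteq> W}" "countable B"
      "\<Union>B = \<Union>{ball x r | x r. 0 < r \<and> cball x r \<subseteq> W}"
    by (rule Lindelof[of "{ball x r | x r. 0 < r \<and> cball x r \<subseteq> W}"]) auto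
  have W: "\<Union>B = W"
  proof
    show "\<Union>B \<subseteq> W"
      using B(1) ball_subset_cball by blast
    show "W \<subseteq> \<Union>B"
    proof
      fix x assume "x \<in> W"
      then obtain r where "0 < r" "cball x r \<subseteq> W"
        using \<open>open W\<close> open_contains_cball by blast
      then show "x \<in> \<Union>B"
        unfolding B(3) using centre_in_ball[of x r] by blast
    qed
  qed
  \<comment> \<open>the empty set is added so that the family can be enumerated even when \<open>W\<close> is empty\<close>
  have "\<exists>s. s \<in> Cc2 W \<and> (\<forall>x. 0 \<le> s x \<and> s x \<le> 1 \<and> (0 < s x \<longleftrightarrow> x \<in> b))" if b: "b \<in> B \<union> {{}}" for b
  proof (cases "b = {}")
    case True
    then show ?thesis
      by (intro exI[of _ "\<lambda>x. 0"]) (auto simp: Cc2_def C2_const compact_supp_def)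
  next
    case False
    then have "b \<in> {ball x r | x r. 0 < r \<and> cball x r \<subseteq> W}"
      using b B(1) by blast
    then obtain p r where r: "b = ball p r" "0 < r" "cball p r \<subseteq> W"
      by blast
    obtain s where s: "s \<in> C2" "\<And>x. 0 \<le> s x" "\<And>x. s x \<le> 1" "\<And>x. 0 < s x \<longleftrightarrow> x \<in> ball p r"
      using exists_bump[OF r(2)] by metis
    have "s x = 0" if "x \<notin> cball p r" for x
      using s(2)[of x] s(4)[of x] that by auto
    then have "s \<in> Cc2 W"
      unfolding Cc2_def compact_supp_def using r(3) s(1) by (auto intro!: exI[of _ "cball p r"])
    then show ?thesis
      using s(2-4) unfolding r(1) by blast
  qed
  then have "\<forall>b\<in>B \<union> {{}}. \<exists>s. s \<in> Cc2 W \<and> (\<forall>x. 0 \<le> s x \<and> s x \<le> 1 \<and> (0 < s x \<longleftrightarrow> x \<in> b))"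
    by (rule ballI)
  from bchoice[OF this] obtain s where
    s0: "\<forall>b\<in>B \<union> {{}}. s b \<in> Cc2 W \<and> (\<forall>x. 0 \<le> s b x \<and> s b x \<le> 1 \<and> (0 < s b x \<longleftrightarrow> x \<in> b))"
    by (rule exE)
  have s: "s b \<in> Cc2 W" "0 \<le> s b x" "s b x \<le> 1" "0 < s b x \<longleftrightarrow> x \<in> b"
    if "b \<in> B \<union> {{}}" for b x
    using bspec[OF s0 that] by simp_all
  define e where "e = from_nat_into (B \<union> {{}})"
  have e: "e i \<in> B \<union> {{}}" for i
    unfolding e_def by (rule from_nat_into) auto
  have e_surj: "\<exists>i. e i = b" if "b \<in> B" for b
    unfolding e_def using from_nat_into_surj[of "B \<union> {{}}" b] B(2) that by auto
  define T where "T = (\<lambda>(n::nat) x. 1 - (\<Prod>i<n. (1 - s (e i) x) ^ n))"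
  have P01: "0 \<le> (\<Prod>i<n. (1 - s (e i) x) ^ n)" "(\<Prod>i<n. (1 - s (e i) x) ^ n) \<le> 1" for n x
    using s(2,3)[OF e] by (auto intro!: prod_nonneg prod_le_1 power_le_one)
  show thesis
  proof
    fix n
    have "T n \<in> C2"
      unfolding T_def by (intro C2_diff C2_const C2_prod C2_power Cc2_C2[OF s(1)] e)
    moreover have "T n \<in> compact_supp W"
    proof -
      have "\<forall>i. \<exists>K. compact K \<and> K \<subseteq> W \<and> (\<forall>x. x \<notin> K \<longrightarrow> s (e i) x = 0)"
        using s(1)[OF e] by (auto simp: Cc2_def compact_supp_def)
      then obtain K where K: "\<And>i. compact (K i)" "\<And>i. K i \<subseteq> W" "\<And>i x. x \<notin> K i \<Longrightarrow> s (e i) x = 0"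
        by metis
      then have "compact (\<Union>i<n. K i)" "(\<Union>i<n. K i) \<subseteq> W"
        "\<And>x. x \<notin> (\<Union>i<n. K i) \<Longrightarrow> T n x = 0"
        by (auto simp: T_def)
      then show ?thesis unfolding compact_supp_def by blast
    qed
    ultimately show "T n \<in> Cc2 W" by (simp add: Cc2_def)
    show "0 \<le> T n x" "T n x \<le> 1" for x
      using P01[of x n] by (auto simp: T_def)
  next
    fix x
    show "(\<lambda>n. T n x) \<longlonglongrightarrow> indicator W x"
    proof (cases "x \<in> W")
      case False
      then have "s (e i) x = 0" for i
        using s(2)[OF e, of i x] s(4)[OF e, of i x] e[of i] W by force
      with False show ?thesis by (simp add: T_def)
    next
      case True
      then obtain i where i: "0 < s (e i) x"
        using W e_surj s(4)[OF e] by (metis Union_iff)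
      let ?y = "1 - s (e i) x"
      have y: "0 \<le> ?y" "?y < 1" using i s(3)[OF e, of i x] by auto
      have "(\<lambda>n. \<Prod>i<n. (1 - s (e i) x) ^ n) \<longlonglongrightarrow> 0"
      proof (rule tendsto_sandwich[OF _ _ tendsto_const LIMSEQ_realpow_zero[OF y]])
        show "\<forall>\<^sub>F n in sequentially. (\<Prod>i<n. (1 - s (e i) x) ^ n) \<le> ?y ^ n"
          using eventually_gt_at_top[of i]
        proof eventually_elim
          case (elim n)
          have "(\<Prod>i<n. (1 - s (e i) x) ^ n) = ?y ^ n * (\<Prod>i\<in>{..<n} - {i}. (1 - s (e i) x) ^ n)"
            using elim by (subst prod.remove[of _ i]) auto
          also have "\<dots> \<le> ?y ^ n * 1"
            using s(2,3)[OF e] y by (intro mult_left_mono prod_le_1) (auto intro!: power_le_one)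
          finally show ?case by simp
        qed
      qed (use P01 in auto)
      from tendsto_diff[OF tendsto_const[of 1] this] True show ?thesis
        by (simp add: T_def)
    qed
  qed
qed

text \<open>The fundamental lemma of the calculus of variations.  Stating it for an arbitrary Borel measure makes it
  apply to the surface measure as well, where it says that restrictions of \<open>C2\<close> functions are dense.\<close>

lemma AE_eq_0_if_orthogonal_to_test_functions:
  fixes f :: "'a::euclidean_space \<Rightarrow> real"
  assumes M: "sets M = sets borel" and f: "integrable M f" and U: "open U"
    and f0: "\<And>x. x \<notin> U \<Longrightarrow> f x = 0"
    and test: "\<And>\<phi>. \<phi> \<in> Cc2 U \<Longrightarrow> (LINT x|M. f x * \<phi> x) = 0"
  shows "AE x in M. f x = 0"
proof (rule AE_eq_0_if_integral_open_eq_0[OF M f])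
  fix V :: "'a set" assume "open V"
  then obtain T where T: "\<And>n::nat. T n \<in> Cc2 (V \<inter> U)" "\<And>n x. 0 \<le> T n x" "\<And>n x. T n x \<le> 1"
      "\<And>x. (\<lambda>n. T n x) \<longlonglongrightarrow> indicator (V \<inter> U) x"
    using open_exhaustion_by_test_functions[of "V \<inter> U"] U by blast
  have meas: "T n \<in> borel_measurable M" for n
    using borel_measurable_continuous_onI[OF C1_continuous[OF C2_imp_C1[OF Cc2_C2[OF T(1)]]]]
      measurable_cong_sets[OF M refl] by blast
  have "(\<lambda>n. LINT x|M. f x * T n x) \<longlonglongrightarrow> (LINT x|M. f x * indicator (V \<inter> U) x)"
  proof (rule integral_dominated_convergence[where w = "\<lambda>x. \<bar>f x\<bar>"])
    have "V \<inter> U \<in> sets M" using \<open>open V\<close> U M by auto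
    then show "(\<lambda>x. f x * indicator (V \<inter> U) x) \<in> borel_measurable M"
      using f by measurable
    show "AE x in M. norm (f x * T n x) \<le> \<bar>f x\<bar>" for n
      using T(2,3)[of n] by (auto simp: abs_mult intro!: mult_left_le)
    show "AE x in M. (\<lambda>n. f x * T n x) \<longlonglongrightarrow> f x * indicator (V \<inter> U) x"
      by (intro always_eventually allI tendsto_intros T(4))
  qed (use f meas in auto)
  moreover have "(LINT x|M. f x * T n x) = 0" for n
    using test T(1)[of n] compact_supp_mono[of "V \<inter> U" U] by (auto simp: Cc2_def)
  ultimately have "(LINT x|M. f x * indicator (V \<inter> U) x) = 0"
    using LIMSEQ_const_iff by (simp add: LIMSEQ_const_iff)
  also have "(\<lambda>x. f x * indicator (V \<inter> U) x) = (\<lambda>x. indicator V x * f x)"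
  proof
    fix x
    show "f x * indicator (V \<inter> U) x = indicator V x * f x"
      using f0[of x] by (cases "x \<in> U") (auto simp: indicator_def)
  qed
  finally show "(LINT x|M. indicator V x * f x) = 0" .
qed

lemma finite_measure_lebesgue_on_bounded:
  assumes "open U" "bounded U"
  shows "finite_measure (lebesgue_on (U :: 'a::euclidean_space set))"
  by (rule finite_measureI)
    (use assms emeasure_bounded_finite[of U] in \<open>auto simp: emeasure_restrict_space\<close>)

text \<open>On Lebesgue-measurable functions the fundamental lemma is applied to a Borel representative of the extension
  by zero.\<close>

lemma AE_lebesgue_on_eq_0:
  fixes f :: "'a::euclidean_space \<Rightarrow> real"
  assumes U: "open U" "bounded U" and f: "f \<in> L2 (lebesgue_on U)"
    and test: "\<And>\<phi>. \<phi> \<in> Cc2 U \<Longrightarrow> (LINT x|lebesgue_on U. f x * \<phi> x) = 0"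
  shows "AE x in lebesgue_on U. f x = 0"
proof -
  have Us: "U \<inter> space lebesgue \<in> sets lebesgue" using U by auto
  let ?F = "\<lambda>x. indicator U x * f x"
  have "integrable (lebesgue_on U) f"
    using L2_integrable[OF f finite_measure_lebesgue_on_bounded[OF U]] .
  then have iF: "integrable lebesgue ?F"
    using integrable_restrict_space[OF Us, of f] by simp
  then obtain g' where g': "g' \<in> borel_measurable lborel" "AE x in lborel. ?F x = g' x"
    using completion_ex_borel_measurable_real[OF borel_measurable_integrable] by blast
  define g where "g = (\<lambda>x. indicator U x * g' x)"
  have gm: "g \<in> borel_measurable lborel"
    unfolding g_def using g'(1) U(1) by (intro borel_measurable_times borel_measurable_indicator) auto
  have ae: "AE x in lborel. ?F x = g x"
    using g'(2) by eventually_elim (auto simp: g_def indicator_def split: if_splits)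
  then have ae': "AE x in lebesgue. ?F x = g x"
    by (rule AE_completion)
  have gm': "g \<in> borel_measurable lebesgue"
    using gm by (rule measurable_completion)
  have "integrable lebesgue g"
    using Bochner_Integration.integrable_cong_AE[OF borel_measurable_integrable[OF iF] gm' ae'] iF by simp
  then have ig: "integrable lborel g"
    using integrable_completion[OF gm] by simp
  have "AE x in lborel. g x = 0"
  proof (rule AE_eq_0_if_orthogonal_to_test_functions[OF _ ig U(1)])
    fix \<phi> :: "'a \<Rightarrow> real" assume \<phi>: "\<phi> \<in> Cc2 U"
    have \<phi>m: "\<phi> \<in> borel_measurable lborel"
      using borel_measurable_continuous_onI[OF C1_continuous[OF C2_imp_C1[OF Cc2_C2[OF \<phi>]]]] by simp
    have "(LINT x|lborel. g x * \<phi> x) = (LINT x|lebesgue. g x * \<phi> x)"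
      by (intro integral_completion[symmetric] borel_measurable_times gm \<phi>m)
    also have "\<dots> = (LINT x|lebesgue. indicator U x *\<^sub>R (f x * \<phi> x))"
      using ae' gm' measurable_completion[OF \<phi>m] borel_measurable_integrable[OF iF]
      by (intro integral_cong_AE) (auto simp flip: mult.assoc)
    also have "\<dots> = 0"
      using test[OF \<phi>] integral_restrict_space[OF Us, of "\<lambda>x. f x * \<phi> x"] by simp
    finally show "(LINT x|lborel. g x * \<phi> x) = 0" .
  qed (auto simp: g_def)
  then have "AE x in lebesgue. g x = 0"
    by (rule AE_completion)
  with ae' have "AE x in lebesgue. x \<in> U \<longrightarrow> f x = 0"
    by eventually_elim (auto simp: indicator_def split: if_splits)
  then show ?thesis
    using AE_restrict_space_iff[OF Us, of "\<lambda>x. f x = 0"] by simp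
qed

lemma continuous_bounded_on_bounded:
  fixes f :: "'a::euclidean_space \<Rightarrow> real"
  assumes "continuous_on UNIV f" "bounded S"
  obtains B where "\<And>x. x \<in> S \<Longrightarrow> \<bar>f x\<bar> \<le> B"
proof -
  have "compact (f ` closure S)"
    using assms by (intro compact_continuous_image) (auto intro: continuous_on_subset)
  then obtain B where "\<forall>y \<in> f ` closure S. norm y \<le> B"
    using compact_imp_bounded bounded_pos by blast
  then show thesis
    using closure_subset[of S] by (intro that[of B]) auto
qed

lemma continuous_L2_lebesgue_on:
  fixes f :: "'a::euclidean_space \<Rightarrow> real"
  assumes "continuous_on UNIV f" "open U" "bounded U"
  shows "f \<in> L2 (lebesgue_on U)"
proof -
  obtain B where "\<And>x. x \<in> U \<Longrightarrow> \<bar>f x\<bar> \<le> B"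
    using continuous_bounded_on_bounded[OF assms(1,3)] by blast
  moreover have "f \<in> borel_measurable (lebesgue_on U)"
    using borel_measurable_continuous_onI[OF assms(1)]
    by (intro measurable_restrict_space1 measurable_completion) simp
  ultimately show ?thesis
    using assms by (intro bounded_L2[of _ _ B] finite_measure_lebesgue_on_bounded) auto
qed

lemma AE_lebesgue_on_eq:
  fixes f g :: "'a::euclidean_space \<Rightarrow> real"
  assumes U: "open U" "bounded U" and L2: "f \<in> L2 (lebesgue_on U)" "g \<in> L2 (lebesgue_on U)"
    and test: "\<And>\<phi>. \<phi> \<in> Cc2 U \<Longrightarrow>
      (LINT x|lebesgue_on U. f x * \<phi> x) = (LINT x|lebesgue_on U. g x * \<phi> x)"
  shows "AE x in lebesgue_on U. f x = g x"
proof -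
  have "AE x in lebesgue_on U. f x - g x = 0"
  proof (rule AE_lebesgue_on_eq_0[OF U L2_diff[OF L2]])
    fix \<phi> :: "'a \<Rightarrow> real" assume \<phi>: "\<phi> \<in> Cc2 U"
    then have "\<phi> \<in> L2 (lebesgue_on U)"
      using U by (intro continuous_L2_lebesgue_on C1_continuous C2_imp_C1 Cc2_C2)
    then show "(LINT x|lebesgue_on U. (f x - g x) * \<phi> x) = 0"
      using test[OF \<phi>] L2 by (simp add: left_diff_distrib L2_mult_integrable)
  qed
  then show ?thesis by eventually_elim simp
qed

section \<open>Integration by parts\<close>

lemma compact_supp_continuous_integrable:
  fixes F :: "'a::euclidean_space \<Rightarrow> real"
  assumes "continuous_on UNIV F" "F \<in> compact_supp U"
  shows "integrable lborel F"
proof -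
  obtain K where K: "compact K" "\<And>x. x \<notin> K \<Longrightarrow> F x = 0"
    using assms(2) by (auto simp: compact_supp_def)
  have "(\<lambda>x. indicator K x *\<^sub>R F x) = F"
    using K(2) by (auto simp: indicator_def fun_eq_iff)
  with borel_integrable_compact[OF K(1), of F] assms(1) continuous_on_subset show ?thesis
    by (metis subset_UNIV)
qed

lemma integral_lebesgue_on_eq_lborel:
  fixes F :: "'a::euclidean_space \<Rightarrow> real"
  assumes U: "open U" and F: "continuous_on UNIV F" "F \<in> compact_supp U"
  shows "(LINT x|lebesgue_on U. F x) = (LINT x|lborel. F x)"
proof -
  have "F x = 0" if "x \<notin> U" for x
    using F(2) that by (auto simp: compact_supp_def)
  then have "(\<lambda>x. indicator U x *\<^sub>R F x) = F"
    by (auto simp: indicator_def fun_eq_iff)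
  moreover have "(LINT x|lebesgue_on U. F x) = (LINT x|lebesgue. indicator U x *\<^sub>R F x)"
    using U by (intro integral_restrict_space) auto
  moreover have "(LINT x|lebesgue. F x) = (LINT x|lborel. F x)"
    using borel_measurable_continuous_onI[OF F(1)] by (intro integral_completion) simp
  ultimately show ?thesis by simp
qed

lemma pd_compact_supp:
  fixes f :: "'a::euclidean_space \<Rightarrow> real"
  assumes "f \<in> compact_supp U"
  shows "pd i f \<in> compact_supp U"
proof -
  obtain K where K: "compact K" "K \<subseteq> U" "\<And>x. x \<notin> K \<Longrightarrow> f x = 0"
    using assms by (auto simp: compact_supp_def)
  have "pd i f x = 0" if "x \<notin> K" for x
  proof (rule pd_eq)
    have "((\<lambda>x. 0::real) has_derivative (\<lambda>h. 0)) (at x)" by simp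
    then show "(f has_derivative (\<lambda>h. 0)) (at x)"
      by (rule has_derivative_transform_within_open[of _ _ _ _ "- K"])
        (use K that in \<open>auto simp: compact_imp_closed open_Compl\<close>)
  qed
  with K(1,2) show ?thesis
    unfolding compact_supp_def mem_Collect_eq by (intro exI[of _ K] conjI allI impI)
qed

lemma compact_supp_if_zero_where:
  assumes "f \<in> compact_supp U" "\<And>x. f x = 0 \<Longrightarrow> g x = 0"
  shows "g \<in> compact_supp U"
proof -
  obtain K where "compact K" "K \<subseteq> U" "\<And>x. x \<notin> K \<Longrightarrow> f x = 0"
    using assms(1) by (auto simp: compact_supp_def)
  with assms(2) show ?thesis
    unfolding compact_supp_def mem_Collect_eq by (intro exI[of _ K]) simp
qed

lemma compact_supp_mult:
  assumes "f \<in> compact_supp U"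
  shows "(\<lambda>x. f x * g x) \<in> compact_supp U" "(\<lambda>x. g x * f x) \<in> compact_supp U"
  using assms by (auto intro: compact_supp_if_zero_where)

text \<open>The partial derivative is the limit of difference quotients, whose integrals vanish by translation
  invariance.  The mean value theorem and the compact support provide the dominating function.\<close>

lemma integral_pd_eq_0:
  fixes f :: "'a::euclidean_space \<Rightarrow> real"
  assumes f: "f \<in> C1" "f \<in> compact_supp U" and i: "i \<in> Basis"
  shows "(LINT x|lborel. pd i f x) = 0"
proof -
  define h where "h n = inverse (real (Suc n))" for n
  have h: "0 < h n" "h n \<le> 1" for n
    by (auto simp: h_def divide_simps)
  have h0: "h \<longlonglongrightarrow> 0"
    unfolding h_def by (rule LIMSEQ_inverse_real_of_nat)
  define D where "D n x = (f (x + h n *\<^sub>R i) - f x) / h n" for n x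
  have line: "((\<lambda>t. f (x + t *\<^sub>R i)) has_real_derivative pd i f (x + t *\<^sub>R i)) (at t)" for x t
  proof -
    have "((\<lambda>t. x + t *\<^sub>R i) has_derivative (\<lambda>t. t *\<^sub>R i)) (at t)"
      by (auto intro!: derivative_eq_intros)
    from has_derivative_compose[OF this C1_has_derivative[OF f(1)]]
    have "((\<lambda>t. f (x + t *\<^sub>R i)) has_derivative (\<lambda>s. pd (s *\<^sub>R i) f (x + t *\<^sub>R i))) (at t)" .
    moreover have "(\<lambda>s. pd (s *\<^sub>R i) f y) = (*) (pd i f y)" for y
      using linear_scale[OF has_derivative_linear[OF C1_has_derivative[OF f(1)]], of _ i y]
      by (intro ext) (simp add: mult.commute)
    ultimately show ?thesis
      by (simp only: has_field_derivative_def)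
  qed
  have cont: "continuous_on UNIV f" "continuous_on UNIV (pd i f)"
    using f(1) i by (auto intro: C1_continuous C1_continuous_pd)
  have meas [measurable]: "f \<in> borel_measurable borel" "pd i f \<in> borel_measurable borel"
    using cont by (auto intro: borel_measurable_continuous_onI)
  have int: "integrable lborel f"
    using compact_supp_continuous_integrable[OF cont(1) f(2)] .
  have shift: "integrable lborel (\<lambda>x. f (x + c))" "(LINT x|lborel. f (x + c)) = (LINT x|lborel. f x)" for c
    using integrable_distr_eq[of "(+) c" lborel borel f] integral_distr[of "(+) c" lborel borel f] int
    by (simp_all add: lborel_distr_plus add.commute[of c])
  have zero: "(LINT x|lborel. D n x) = 0" for n
    unfolding D_def using shift int by simp
  \<comment> \<open>\<open>D n\<close> lives on the ball of radius \<open>R + 1\<close>, and the mean value theorem looks at most one unit further\<close>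
  obtain R where R: "\<And>x. norm x > R \<Longrightarrow> f x = 0" "R > 0"
  proof -
    obtain K where K: "compact K" "\<And>x. x \<notin> K \<Longrightarrow> f x = 0"
      using f(2) by (auto simp: compact_supp_def)
    obtain R where "R > 0" "\<And>x. x \<in> K \<Longrightarrow> norm x \<le> R"
      using compact_imp_bounded[OF K(1)] by (auto simp: bounded_pos)
    with K(2) that[of R] show thesis by force
  qed
  have "compact (pd i f ` cball 0 (R + 2))"
    using cont(2) continuous_on_subset by (intro compact_continuous_image) auto
  then obtain B where "B > 0" "\<forall>y \<in> pd i f ` cball 0 (R + 2). norm y \<le> B"
    using compact_imp_bounded bounded_pos by blast
  then have B: "\<And>x. norm x \<le> R + 2 \<Longrightarrow> \<bar>pd i f x\<bar> \<le> B" "B > 0"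
    by auto
  have bound: "\<bar>D n x\<bar> \<le> B * indicator (cball 0 (R + 1)) x" for n x
  proof (cases "norm x \<le> R + 1")
    case True
    obtain z where z: "0 < z" "z < h n" "f (x + h n *\<^sub>R i) - f (x + 0 *\<^sub>R i) = (h n - 0) * pd i f (x + z *\<^sub>R i)"
      using MVT2[OF h(1)[of n], of "\<lambda>t. f (x + t *\<^sub>R i)" "\<lambda>t. pd i f (x + t *\<^sub>R i)"] line by blast
    have "norm (x + z *\<^sub>R i) \<le> norm x + z"
      using norm_triangle_ineq[of x "z *\<^sub>R i"] i z(1) by simp
    then have "\<bar>pd i f (x + z *\<^sub>R i)\<bar> \<le> B"
      using True z(2) h(2)[of n] by (intro B) linarith
    moreover have "D n x = pd i f (x + z *\<^sub>R i)"
      using z(3) h(1)[of n] by (simp add: D_def)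
    ultimately show ?thesis using True by simp
  next
    case False
    have "norm x \<le> norm (x + h n *\<^sub>R i) + h n"
      using norm_triangle_ineq4[of "x + h n *\<^sub>R i" "h n *\<^sub>R i"] i h(1)[of n] by simp
    then have "f (x + h n *\<^sub>R i) = 0" "f x = 0"
      using False h(2)[of n] R(2) by (auto intro!: R(1))
    then show ?thesis using B(2) by (simp add: D_def)
  qed
  have "(\<lambda>n. LINT x|lborel. D n x) \<longlonglongrightarrow> (LINT x|lborel. pd i f x)"
  proof (rule integral_dominated_convergence[where w = "\<lambda>x. B * indicator (cball 0 (R + 1)) x"])
    show "integrable lborel (\<lambda>x. B * indicator (cball 0 (R + 1)) x :: real)"
      by (intro integrable_mult_right) (auto intro!: integrable_real_indicator emeasure_bounded_finite)
    show "AE x in lborel. (\<lambda>n. D n x) \<longlonglongrightarrow> pd i f x"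
    proof (intro always_eventually allI)
      fix x
      have "((\<lambda>t. (f (x + t *\<^sub>R i) - f x) / t) \<longlongrightarrow> pd i f x) (at 0)"
        using line[of x 0] by (simp add: DERIV_def)
      moreover have "filterlim h (at 0) sequentially"
        using h0 h(1) by (auto simp: filterlim_at less_le intro!: always_eventually)
      ultimately show "(\<lambda>n. D n x) \<longlonglongrightarrow> pd i f x"
        unfolding D_def by (rule filterlim_compose)
    qed
    show "AE x in lborel. norm (D n x) \<le> B * indicator (cball 0 (R + 1)) x" for n
      using bound by simp
    show "D n \<in> borel_measurable lborel" for n
      unfolding D_def by measurable
  qed measurable
  then show ?thesis
    by (simp add: zero LIMSEQ_const_iff)
qed

lemma integration_by_parts:
  fixes f :: "'a::euclidean_space \<Rightarrow> real"
  assumes U: "open U" and f: "f \<in> C1" and \<phi>: "\<phi> \<in> Cc1 U" and i: "i \<in> Basis"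
  shows "(LINT x|lebesgue_on U. f x * pd i \<phi> x) = - (LINT x|lebesgue_on U. pd i f x * \<phi> x)"
proof -
  have \<phi>1: "\<phi> \<in> C1" and \<phi>c: "\<phi> \<in> compact_supp U"
    using \<phi> by (auto simp: Cc1_def)
  have c: "continuous_on UNIV (\<lambda>x. f x * pd i \<phi> x)" "continuous_on UNIV (\<lambda>x. pd i f x * \<phi> x)"
    using f \<phi>1 i by (auto intro!: continuous_on_mult simp: C1_continuous C1_continuous_pd)
  have s: "(\<lambda>x. f x * pd i \<phi> x) \<in> compact_supp U" "(\<lambda>x. pd i f x * \<phi> x) \<in> compact_supp U"
    using \<phi>c pd_compact_supp[OF \<phi>c] compact_supp_mult by blast+
  have "(LINT x|lborel. f x * pd i \<phi> x + pd i f x * \<phi> x) = 0"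
    using integral_pd_eq_0[OF C1_mult[OF f \<phi>1] compact_supp_mult(2)[OF \<phi>c] i]
    by (simp add: pd_mult[OF f \<phi>1])
  then have "(LINT x|lborel. f x * pd i \<phi> x) + (LINT x|lborel. pd i f x * \<phi> x) = 0"
    using compact_supp_continuous_integrable[OF c(1) s(1)] compact_supp_continuous_integrable[OF c(2) s(2)]
    by simp
  then show ?thesis
    using integral_lebesgue_on_eq_lborel[OF U c(1) s(1)] integral_lebesgue_on_eq_lborel[OF U c(2) s(2)]
    by simp
qed

section \<open>Weak and normal derivatives of test functions\<close>

lemma sets_hausdorff_measure: "sets (hausdorff_measure k) = sets borel"
  using sets.sigma_sets_eq[of borel] by (simp add: hausdorff_measure_def sets_measure_of_conv)

lemma space_hausdorff_measure: "space (hausdorff_measure k) = UNIV"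
  by (simp add: hausdorff_measure_def space_measure_of_conv)

lemma space_surface_measure: "space (surface_measure \<Omega>) = frontier \<Omega>"
  by (simp add: surface_measure_def space_restrict_space space_hausdorff_measure)

lemma finite_surface_measure:
  fixes \<Omega> :: "'a::euclidean_space set"
  assumes "B1 \<Omega>"
  shows "finite_measure (surface_measure \<Omega>)"
proof (rule finite_measureI)
  let ?H = "hausdorff_measure (DIM('a) - 1) :: 'a measure"
  obtain F where F: "finite F" "\<Union>F = frontier \<Omega>"
      "\<And>S. S \<in> F \<Longrightarrow> closed_lipschitz_surface S" "\<And>S. S \<in> F \<Longrightarrow> emeasure ?H S < \<infinity>"
    using assms by (auto simp: B1_def)
  have "S \<in> sets ?H" if "S \<in> F" for S
    using F(3)[OF that] by (auto simp: closed_lipschitz_surface_def sets_hausdorff_measure compact_imp_closed)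
  then have "emeasure ?H (\<Union>S\<in>F. S) \<le> (\<Sum>S\<in>F. emeasure ?H S)"
    using F(1) by (intro emeasure_subadditive_finite) auto
  also have "\<dots> < \<infinity>"
    using F(1,4) by simp
  finally have "emeasure ?H (frontier \<Omega>) < \<infinity>"
    using F(2) by simp
  moreover have "emeasure (surface_measure \<Omega>) (frontier \<Omega>) = emeasure ?H (frontier \<Omega>)"
    unfolding surface_measure_def
    by (rule emeasure_restrict_space) (auto simp: sets_hausdorff_measure space_hausdorff_measure)
  ultimately show "emeasure (surface_measure \<Omega>) (space (surface_measure \<Omega>)) \<noteq> \<infinity>"
    by (simp add: space_surface_measure)
qed

text \<open>Uniqueness of normal derivatives: the traces of \<open>C2\<close> functions are enough to separate
  square-integrable functions on the boundary.\<close>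

lemma AE_surface_measure_eq_0:
  fixes \<Omega> :: "'a::euclidean_space set"
  assumes "B1 \<Omega>" and d: "d \<in> L2 (surface_measure \<Omega>)"
    and test: "\<And>\<phi>. \<phi> \<in> Cc2 UNIV \<Longrightarrow> (LINT z|surface_measure \<Omega>. \<phi> z * d z) = 0"
  shows "AE z in surface_measure \<Omega>. d z = 0"
proof -
  let ?H = "hausdorff_measure (DIM('a) - 1) :: 'a measure"
  have fr: "frontier \<Omega> \<inter> space ?H \<in> sets ?H"
    by (simp add: sets_hausdorff_measure space_hausdorff_measure)
  have "integrable (surface_measure \<Omega>) d"
    using L2_integrable[OF d finite_surface_measure[OF assms(1)]] .
  then have i: "integrable ?H (\<lambda>z. indicator (frontier \<Omega>) z * d z)"
    unfolding surface_measure_def using integrable_restrict_space[OF fr, of d] by simp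
  have "AE z in ?H. indicator (frontier \<Omega>) z * d z = 0"
  proof (rule AE_eq_0_if_orthogonal_to_test_functions[OF sets_hausdorff_measure i open_UNIV])
    fix \<phi> :: "'a \<Rightarrow> real" assume "\<phi> \<in> Cc2 UNIV"
    from test[OF this] show "(LINT z|?H. indicator (frontier \<Omega>) z * d z * \<phi> z) = 0"
      unfolding surface_measure_def integral_restrict_space[OF fr]
      by (simp add: mult_ac)
  qed auto
  then show ?thesis
    unfolding surface_measure_def AE_restrict_space_iff[OF fr]
    by eventually_elim (auto simp: indicator_def)
qed

definition grad :: "('a::euclidean_space \<Rightarrow> real) \<Rightarrow> 'a \<Rightarrow> 'a" where
  "grad f x = (\<Sum>i\<in>Basis. pd i f x *\<^sub>R i)"

lemma grad_inner: "i \<in> Basis \<Longrightarrow> grad f x \<bullet> i = pd i f x"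
  by (simp add: grad_def)

lemma grad_inner_grad: "grad f x \<bullet> grad g x = (\<Sum>i\<in>Basis. pd i f x * pd i g x)"
  by (subst euclidean_inner) (simp add: grad_inner)

lemma C1_is_weak_gradient:
  assumes "open \<Omega>" "bounded \<Omega>" "f \<in> C1"
  shows "is_weak_gradient \<Omega> f (grad f)"
  unfolding is_weak_gradient_def
  using assms by (auto simp: grad_inner integration_by_parts intro!: continuous_L2_lebesgue_on C1_continuous_pd)

lemma C1_H1:
  assumes "open \<Omega>" "bounded \<Omega>" "f \<in> C1"
  shows "f \<in> H1 \<Omega>"
  using C1_is_weak_gradient[OF assms] continuous_L2_lebesgue_on[OF C1_continuous] assms
  by (auto simp: H1_def)

lemma weak_gradient_is_weak_gradient:
  "is_weak_gradient \<Omega> u G \<Longrightarrow> is_weak_gradient \<Omega> u (weak_gradient \<Omega> u)"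
  unfolding weak_gradient_def by (metis someI)

lemma weak_laplacian_is_weak_laplacian:
  "is_weak_laplacian \<Omega> u f \<Longrightarrow> is_weak_laplacian \<Omega> u (weak_laplacian \<Omega> u)"
  unfolding weak_laplacian_def by (metis someI)

text \<open>\<^const>\<open>weak_gradient\<close> is an arbitrary choice, so classical derivatives can replace it only after
  uniqueness almost everywhere is known; the same holds for the Laplacian.\<close>

lemma weak_gradient_unique:
  fixes \<Omega> :: "'a::euclidean_space set"
  assumes \<Omega>: "open \<Omega>" "bounded \<Omega>" and G: "is_weak_gradient \<Omega> u G"
  shows "AE x in lebesgue_on \<Omega>. weak_gradient \<Omega> u x = G x"
proof -
  have W: "is_weak_gradient \<Omega> u (weak_gradient \<Omega> u)"
    using G by (rule weak_gradient_is_weak_gradient)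
  have "AE x in lebesgue_on \<Omega>. weak_gradient \<Omega> u x \<bullet> i = G x \<bullet> i" if "i \<in> Basis" for i
  proof (rule AE_lebesgue_on_eq[OF \<Omega>])
    show "(\<lambda>x. weak_gradient \<Omega> u x \<bullet> i) \<in> L2 (lebesgue_on \<Omega>)" "(\<lambda>x. G x \<bullet> i) \<in> L2 (lebesgue_on \<Omega>)"
      using W G that by (auto simp: is_weak_gradient_def)
    show "(LINT x|lebesgue_on \<Omega>. (weak_gradient \<Omega> u x \<bullet> i) * \<phi> x)
        = (LINT x|lebesgue_on \<Omega>. (G x \<bullet> i) * \<phi> x)" if "\<phi> \<in> Cc2 \<Omega>" for \<phi>
      using W G \<open>i \<in> Basis\<close> Cc2_imp_Cc1[OF that] by (simp add: is_weak_gradient_def)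
  qed
  then have "AE x in lebesgue_on \<Omega>. \<forall>i\<in>Basis. weak_gradient \<Omega> u x \<bullet> i = G x \<bullet> i"
    by (intro AE_finite_allI) auto
  then show ?thesis
    by eventually_elim (auto intro: euclidean_eqI)
qed

lemma weak_laplacian_unique:
  fixes \<Omega> :: "'a::euclidean_space set"
  assumes \<Omega>: "open \<Omega>" "bounded \<Omega>" and f: "is_weak_laplacian \<Omega> u f"
  shows "AE x in lebesgue_on \<Omega>. weak_laplacian \<Omega> u x = f x"
  using f weak_laplacian_is_weak_laplacian[OF f]
  by (intro AE_lebesgue_on_eq[OF \<Omega>]) (auto simp: is_weak_laplacian_def)

lemma H1_norm_zero:
  assumes "open \<Omega>" "bounded \<Omega>"
  shows "H1_norm \<Omega> (\<lambda>x. 0) = 0"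
proof -
  have "is_weak_gradient \<Omega> (\<lambda>x. 0) (\<lambda>x. 0)"
    by (simp add: is_weak_gradient_def L2_zero)
  from weak_gradient_unique[OF assms this]
  have "AE x in lebesgue_on \<Omega>. 0\<^sup>2 + (norm (weak_gradient \<Omega> (\<lambda>x. 0) x))\<^sup>2 = 0"
    by eventually_elim simp
  from integral_eq_zero_AE[OF this] show ?thesis
    unfolding H1_norm_def by simp
qed

lemma Cc2_pd: "v \<in> Cc2 \<Omega> \<Longrightarrow> i \<in> Basis \<Longrightarrow> pd i v \<in> Cc1 \<Omega>"
  by (auto simp: Cc2_def Cc1_def C2_pd pd_compact_supp)

lemma classical_laplacian_L2:
  assumes "open \<Omega>" "bounded \<Omega>" "v \<in> C2"
  shows "classical_laplacian v \<in> L2 (lebesgue_on \<Omega>)"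
proof -
  have "(\<lambda>x. \<Sum>i\<in>Basis. pd i (pd i v) x) \<in> L2 (lebesgue_on \<Omega>)"
    using assms by (intro L2_sum continuous_L2_lebesgue_on C1_continuous_pd C2_pd)
  then show ?thesis
    by (simp add: classical_laplacian_def[abs_def])
qed

text \<open>No boundary term appears because \<open>v\<close> has compact support in the region.\<close>

lemma Green_first_identity:
  fixes \<Omega> :: "'a::euclidean_space set"
  assumes \<Omega>: "open \<Omega>" "bounded \<Omega>" and f: "f \<in> C1" and v: "v \<in> Cc2 \<Omega>"
  shows "(LINT x|lebesgue_on \<Omega>. f x * classical_laplacian v x)
    = - (\<Sum>i\<in>Basis. LINT x|lebesgue_on \<Omega>. pd i f x * pd i v x)"
proof -
  have "(LINT x|lebesgue_on \<Omega>. f x * classical_laplacian v x)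
      = (\<Sum>i\<in>Basis. LINT x|lebesgue_on \<Omega>. f x * pd i (pd i v) x)"
    unfolding classical_laplacian_def sum_distrib_left
  proof (rule Bochner_Integration.integral_sum)
    fix i :: 'a assume "i \<in> Basis"
    then show "integrable (lebesgue_on \<Omega>) (\<lambda>x. f x * pd i (pd i v) x)"
      using \<Omega> f Cc2_C2[OF v]
      by (intro L2_mult_integrable continuous_L2_lebesgue_on C1_continuous_pd C1_continuous C2_pd)
  qed
  also have "\<dots> = (\<Sum>i\<in>Basis. - (LINT x|lebesgue_on \<Omega>. pd i f x * pd i v x))"
    using integration_by_parts[OF \<Omega>(1) f Cc2_pd[OF v]] by (intro sum.cong) auto
  finally show ?thesis by (simp add: sum_negf)
qed

lemma Cc2_is_weak_laplacian:
  assumes \<Omega>: "open \<Omega>" "bounded \<Omega>" and v: "v \<in> Cc2 \<Omega>"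
  shows "is_weak_laplacian \<Omega> v (classical_laplacian v)"
  unfolding is_weak_laplacian_def
proof (intro conjI ballI)
  show "classical_laplacian v \<in> L2 (lebesgue_on \<Omega>)"
    using \<Omega> Cc2_C2[OF v] by (rule classical_laplacian_L2)
  fix \<phi> assume \<phi>: "\<phi> \<in> Cc2 \<Omega>"
  show "(LINT x|lebesgue_on \<Omega>. v x * classical_laplacian \<phi> x) =
      (LINT x|lebesgue_on \<Omega>. classical_laplacian v x * \<phi> x)"
    using Green_first_identity[OF \<Omega> C2_imp_C1[OF Cc2_C2[OF v]] \<phi>]
      Green_first_identity[OF \<Omega> C2_imp_C1[OF Cc2_C2[OF \<phi>]] v]
    by (simp add: mult.commute)
qed

lemma Cc2_H0Delta:
  assumes \<Omega>: "open \<Omega>" "bounded \<Omega>" and v: "v \<in> Cc2 \<Omega>"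
  shows "v \<in> H0Delta \<Omega>"
proof -
  have "v \<in> H10 \<Omega>"
    unfolding H10_def using C1_H1[OF \<Omega> C2_imp_C1[OF Cc2_C2[OF v]]] Cc2_imp_Cc1[OF v] H1_norm_zero[OF \<Omega>]
    by (auto intro!: exI[of _ "\<lambda>n. v"])
  then show ?thesis
    using Cc2_is_weak_laplacian[OF assms] by (auto simp: H0Delta_def)
qed

text \<open>A \<open>C1\<close> function is continuous up to the boundary, so the constant sequence shows that it is its own
  trace.\<close>

lemma C1_is_trace:
  assumes \<Omega>: "open \<Omega>" "B1 \<Omega>" and t: "t \<in> C1"
  shows "is_trace \<Omega> t t"
proof -
  have bd: "bounded \<Omega>" using \<Omega>(2) by (simp add: B1_def)
  have bdf: "bounded (frontier \<Omega>)"
    using bounded_closure[OF bd] by (rule bounded_subset) (simp add: frontier_def)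
  have c: "continuous_on UNIV t" using t by (rule C1_continuous)
  obtain B where "\<And>x. x \<in> frontier \<Omega> \<Longrightarrow> \<bar>t x\<bar> \<le> B"
    using continuous_bounded_on_bounded[OF c bdf] by blast
  moreover have "t \<in> borel_measurable (surface_measure \<Omega>)"
    unfolding surface_measure_def using borel_measurable_continuous_onI[OF c]
    by (intro measurable_restrict_space1) (simp add: measurable_cong_sets[OF sets_hausdorff_measure refl])
  ultimately have "t \<in> L2 (surface_measure \<Omega>)"
    by (intro bounded_L2[of _ _ B] finite_surface_measure \<Omega>) (auto simp: space_surface_measure)
  then show ?thesis
    unfolding is_trace_def using C1_H1[OF \<Omega>(1) bd t] H1_norm_zero[OF \<Omega>(1) bd] continuous_on_subset[OF c]
    by (auto intro!: exI[of _ "\<lambda>n. t"] simp: L2_norm_def)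
qed

text \<open>Green's identity makes the integral that defines the normal derivative of \<open>v\<close> vanish for every
  \<open>C1\<close> trace, and such traces determine it almost everywhere.\<close>

lemma normal_deriv_Cc2:
  fixes \<Omega> :: "'a::euclidean_space set"
  assumes \<Omega>: "open \<Omega>" "B2 \<Omega>" and v: "v \<in> Cc2 \<Omega>"
  shows "AE z in surface_measure \<Omega>. normal_deriv \<Omega> v z = 0"
proof -
  have B1: "B1 \<Omega>" using \<Omega>(2) by (simp add: B2_def)
  then have bd: "bounded \<Omega>" by (simp add: B1_def)
  let ?M = "lebesgue_on \<Omega>"
  have "\<exists>d. is_normal_deriv \<Omega> v d"
    using \<Omega>(2) Cc2_H0Delta[OF \<Omega>(1) bd v] by (simp add: B2_def)
  then have d: "is_normal_deriv \<Omega> v (normal_deriv \<Omega> v)"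
    unfolding normal_deriv_def by (rule someI_ex)
  show ?thesis
  proof (rule AE_surface_measure_eq_0[OF B1])
    show "normal_deriv \<Omega> v \<in> L2 (surface_measure \<Omega>)"
      using d by (simp add: is_normal_deriv_def)
    fix t :: "'a \<Rightarrow> real" assume "t \<in> Cc2 UNIV"
    then have t: "t \<in> C1" by (intro C2_imp_C1 Cc2_C2)
    have v1: "v \<in> C1" using Cc2_C2[OF v] by (rule C2_imp_C1)
    note Gv = C1_is_weak_gradient[OF \<Omega>(1) bd v1] and Gt = C1_is_weak_gradient[OF \<Omega>(1) bd t]
      and Lv = Cc2_is_weak_laplacian[OF \<Omega>(1) bd v]
    let ?I = "\<lambda>x. weak_gradient \<Omega> v x \<bullet> weak_gradient \<Omega> t x + t x * weak_laplacian \<Omega> v x"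
    let ?J = "\<lambda>x. (\<Sum>i\<in>Basis. pd i t x * pd i v x) + t x * classical_laplacian v x"
    have tL: "t \<in> L2 ?M"
      using \<Omega>(1) bd t by (intro continuous_L2_lebesgue_on C1_continuous)
    have "AE x in ?M. ?I x = ?J x"
      using weak_gradient_unique[OF \<Omega>(1) bd Gv] weak_gradient_unique[OF \<Omega>(1) bd Gt]
        weak_laplacian_unique[OF \<Omega>(1) bd Lv]
      by eventually_elim (simp add: grad_inner_grad mult.commute)
    moreover have g: "integrable ?M (\<lambda>x. pd i t x * pd i v x)" if "i \<in> Basis" for i
      using that \<Omega>(1) bd t v1 by (intro L2_mult_integrable continuous_L2_lebesgue_on C1_continuous_pd)
    have l: "integrable ?M (\<lambda>x. t x * classical_laplacian v x)"
      using \<Omega>(1) bd tL Cc2_C2[OF v] by (intro L2_mult_integrable classical_laplacian_L2)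
    have "integrable ?M ?J"
      using g l by (intro Bochner_Integration.integrable_add Bochner_Integration.integrable_sum)
    then have "?J \<in> borel_measurable ?M" by (rule borel_measurable_integrable)
    moreover have "integrable ?M ?I"
    proof (intro Bochner_Integration.integrable_add)
      show "integrable ?M (\<lambda>x. t x * weak_laplacian \<Omega> v x)"
        using tL weak_laplacian_is_weak_laplacian[OF Lv] by (auto simp: is_weak_laplacian_def intro: L2_mult_integrable)
      have "integrable ?M (\<lambda>x. \<Sum>i\<in>Basis. (weak_gradient \<Omega> v x \<bullet> i) * (weak_gradient \<Omega> t x \<bullet> i))"
        using weak_gradient_is_weak_gradient[OF Gv] weak_gradient_is_weak_gradient[OF Gt]
        by (intro Bochner_Integration.integrable_sum L2_mult_integrable) (auto simp: is_weak_gradient_def)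
      then show "integrable ?M (\<lambda>x. weak_gradient \<Omega> v x \<bullet> weak_gradient \<Omega> t x)"
        by (subst euclidean_inner)
    qed
    then have "?I \<in> borel_measurable ?M" by (rule borel_measurable_integrable)
    ultimately have "(LINT x|?M. ?I x) = (LINT x|?M. ?J x)"
      by (intro integral_cong_AE)
    also have "\<dots> = 0"
      using Green_first_identity[OF \<Omega>(1) bd t v] g l
      by (simp add: Bochner_Integration.integral_sum Bochner_Integration.integrable_sum)
    finally have eqI: "(LINT x|?M. ?I x) = 0" .
    show "(LINT z|surface_measure \<Omega>. t z * normal_deriv \<Omega> v z) = 0"
      using d C1_H1[OF \<Omega>(1) bd t] C1_is_trace[OF \<Omega>(1) B1 t] eqI by (simp add: is_normal_deriv_def)
  qed
qed

section \<open>The harmonic extension and its finite-rank approximations\<close>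

text \<open>Test the eigenvalue equation with \<open>v\<close>; the boundary side vanishes together with the normal derivative
  of \<open>v\<close>.\<close>

lemma harmonic_Laplacian_of_eigenfunction:
  fixes \<Omega> :: "'a::euclidean_space set"
  assumes \<Omega>: "open \<Omega>" "B2 \<Omega>" and b: "DBS_eigenpair \<Omega> q b" and v: "v \<in> Cc2 \<Omega>"
  shows "(LINT x|lebesgue_on \<Omega>. weak_laplacian \<Omega> b x * classical_laplacian v x) = 0"
proof -
  have bd: "bounded \<Omega>" using \<Omega>(2) by (simp add: B2_def B1_def)
  have vH: "v \<in> H0Delta \<Omega>" using \<Omega>(1) bd v by (rule Cc2_H0Delta)
  have Lv: "is_weak_laplacian \<Omega> v (classical_laplacian v)"
    using \<Omega>(1) bd v by (rule Cc2_is_weak_laplacian)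
  have Lb: "weak_laplacian \<Omega> b \<in> L2 (lebesgue_on \<Omega>)"
    using b weak_laplacian_is_weak_laplacian by (fastforce simp: DBS_eigenpair_def H0Delta_def is_weak_laplacian_def)
  have meas: "(\<lambda>x. weak_laplacian \<Omega> b x * classical_laplacian v x) \<in> borel_measurable (lebesgue_on \<Omega>)"
    "(\<lambda>x. weak_laplacian \<Omega> b x * weak_laplacian \<Omega> v x) \<in> borel_measurable (lebesgue_on \<Omega>)"
    using L2_mult_integrable[OF Lb] Lv weak_laplacian_is_weak_laplacian[OF Lv]
    by (auto simp: is_weak_laplacian_def)
  have "(LINT x|lebesgue_on \<Omega>. weak_laplacian \<Omega> b x * classical_laplacian v x) = inner_Delta \<Omega> b v"
    unfolding inner_Delta_def
  proof (rule integral_cong_AE[OF meas])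
    show "AE x in lebesgue_on \<Omega>. weak_laplacian \<Omega> b x * classical_laplacian v x
        = weak_laplacian \<Omega> b x * weak_laplacian \<Omega> v x"
      using weak_laplacian_unique[OF \<Omega>(1) bd Lv] by eventually_elim simp
  qed
  also have "\<dots> = q * (LINT z|surface_measure \<Omega>. normal_deriv \<Omega> b z * normal_deriv \<Omega> v z)"
    using b vH by (simp add: DBS_eigenpair_def)
  also have "AE z in surface_measure \<Omega>. normal_deriv \<Omega> b z * normal_deriv \<Omega> v z = 0"
    using normal_deriv_Cc2[OF \<Omega> v] by eventually_elim simp
  then have "(LINT z|surface_measure \<Omega>. normal_deriv \<Omega> b z * normal_deriv \<Omega> v z) = 0"
    by (rule integral_eq_zero_AE)
  finally show ?thesis by simp
qed

lemma L2H_sum: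
  assumes "\<And>j. j \<in> J \<Longrightarrow> h j \<in> L2H \<Omega>" and \<Omega>: "open \<Omega>" "bounded \<Omega>"
  shows "(\<lambda>x. \<Sum>j\<in>J. c j * h j x) \<in> L2H \<Omega>"
  unfolding L2H_def
proof (intro CollectI conjI ballI)
  have hL: "h j \<in> L2 (lebesgue_on \<Omega>)" if "j \<in> J" for j
    using assms(1)[OF that] by (simp add: L2H_def)
  then show "(\<lambda>x. \<Sum>j\<in>J. c j * h j x) \<in> L2 (lebesgue_on \<Omega>)"
    by (intro L2_sum L2_scale)
  fix v assume v: "v \<in> Cc2 \<Omega>"
  have "(LINT x|lebesgue_on \<Omega>. (\<Sum>j\<in>J. c j * h j x) * classical_laplacian v x)
      = (\<Sum>j\<in>J. c j * (LINT x|lebesgue_on \<Omega>. h j x * classical_laplacian v x))"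
    using hL \<Omega> Cc2_C2[OF v] by (intro integral_sum_mult classical_laplacian_L2)
  also have "\<dots> = 0"
    using assms(1) v by (intro sum.neutral) (auto simp: L2H_def)
  finally show "(LINT x|lebesgue_on \<Omega>. (\<Sum>j\<in>J. c j * h j x) * classical_laplacian v x) = 0" .
qed

lemma L2H_closed:
  assumes \<Omega>: "open \<Omega>" "bounded \<Omega>" and S: "\<And>n::nat. S n \<in> L2H \<Omega>" and f: "f \<in> L2 (lebesgue_on \<Omega>)"
    and lim: "(\<lambda>n. L2_norm (lebesgue_on \<Omega>) (\<lambda>x. f x - S n x)) \<longlonglongrightarrow> 0"
  shows "f \<in> L2H \<Omega>"
  unfolding L2H_def
proof (intro CollectI conjI ballI f)
  let ?M = "lebesgue_on \<Omega>"
  fix v assume v: "v \<in> Cc2 \<Omega>"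
  let ?l = "classical_laplacian v"
  have l: "?l \<in> L2 ?M" using \<Omega> Cc2_C2[OF v] by (rule classical_laplacian_L2)
  have SL: "S n \<in> L2 ?M" for n using S by (simp add: L2H_def)
  have le: "\<bar>LINT x|?M. f x * ?l x\<bar> \<le> L2_norm ?M (\<lambda>x. f x - S n x) * L2_norm ?M ?l" for n
  proof -
    have "(LINT x|?M. (f x - S n x) * ?l x) = (LINT x|?M. f x * ?l x) - (LINT x|?M. S n x * ?l x)"
      using L2_mult_integrable[OF f l] L2_mult_integrable[OF SL l] by (simp add: left_diff_distrib)
    also have "(LINT x|?M. S n x * ?l x) = 0"
      using S v by (simp add: L2H_def)
    finally show ?thesis
      using L2_Cauchy_Schwarz[OF L2_diff[OF f SL] l, of n] by simp
  qed
  have "(\<lambda>n. L2_norm ?M (\<lambda>x. f x - S n x) * L2_norm ?M ?l) \<longlonglongrightarrow> 0"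
    using tendsto_mult_right[OF lim, of "L2_norm ?M ?l"] by simp
  then have "\<bar>LINT x|?M. f x * ?l x\<bar> \<le> 0"
    by (rule LIMSEQ_le_const) (use le in auto)
  then show "(LINT x|?M. f x * ?l x) = 0" by simp
qed

lemma normal_deriv_L2:
  assumes "B2 \<Omega>" "u \<in> H0Delta \<Omega>"
  shows "normal_deriv \<Omega> u \<in> L2 (surface_measure \<Omega>)"
proof -
  have "\<exists>d. is_normal_deriv \<Omega> u d" using assms by (simp add: B2_def)
  then have "is_normal_deriv \<Omega> u (normal_deriv \<Omega> u)"
    unfolding normal_deriv_def by (rule someI_ex)
  then show ?thesis by (simp add: is_normal_deriv_def)
qed

lemma weak_laplacian_L2:
  assumes "u \<in> H0Delta \<Omega>"
  shows "weak_laplacian \<Omega> u \<in> L2 (lebesgue_on \<Omega>)"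
  using assms weak_laplacian_is_weak_laplacian
  by (fastforce simp: H0Delta_def is_weak_laplacian_def)

locale DBS_system =
  fixes \<Omega> :: "'a::euclidean_space set" and b :: "nat \<Rightarrow> 'a \<Rightarrow> real" and q :: "nat \<Rightarrow> real"
  assumes open_\<Omega>: "open \<Omega>" and B2: "B2 \<Omega>" and constructed: "DBS_constructed \<Omega> b q"
    and orthonormal: "Delta_orthonormal \<Omega> b"
    and eigenpair: "j \<ge> 1 \<Longrightarrow> DBS_eigenpair \<Omega> (q j) (b j)"
begin

abbreviation "\<sigma> \<equiv> surface_measure \<Omega>"
abbreviation "A \<equiv> surface_area \<Omega>"

text \<open>Normalised in \<open>L2\<close> of the surface measure itself, that is, \<^const>\<open>dbs_w\<close> without the factor
  \<open>sqrt |\<partial>\<Omega>|\<close> that belongs to the averaged inner product.\<close>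

definition u :: "nat \<Rightarrow> 'a \<Rightarrow> real" where
  "u j z = sqrt (q j) * normal_deriv \<Omega> (b j) z"

lemma bounded_\<Omega>: "bounded \<Omega>"
  using B2 by (simp add: B2_def B1_def)

lemma b_H0Delta: "j \<ge> 1 \<Longrightarrow> b j \<in> H0Delta \<Omega>"
  using orthonormal by (simp add: Delta_orthonormal_def)

text \<open>The eigenvalue equation for \<open>b j\<close> tested with \<open>b k\<close> carries orthonormality from the region to the
  boundary.\<close>

lemma inner_normal_deriv:
  assumes "j \<ge> 1" "k \<ge> 1"
  shows "q j * (LINT z|\<sigma>. normal_deriv \<Omega> (b j) z * normal_deriv \<Omega> (b k) z) = (if j = k then 1 else 0)"
proof -
  have "inner_Delta \<Omega> (b j) (b k)
      = q j * (LINT z|\<sigma>. normal_deriv \<Omega> (b j) z * normal_deriv \<Omega> (b k) z)"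
    using eigenpair[OF assms(1)] b_H0Delta[OF assms(2)] by (simp add: DBS_eigenpair_def)
  then show ?thesis
    using orthonormal assms by (simp add: Delta_orthonormal_def)
qed

lemma q_mult_bdry_energy: "j \<ge> 1 \<Longrightarrow> q j * bdry_energy \<Omega> (b j) = 1"
  using inner_normal_deriv[of j j] by (simp add: bdry_energy_def power2_eq_square)

lemma bdry_energy_nonneg: "0 \<le> bdry_energy \<Omega> v"
  by (simp add: bdry_energy_def)

lemma q_pos:
  assumes "j \<ge> 1"
  shows "0 < q j"
  using q_mult_bdry_energy[OF assms] bdry_energy_nonneg[of "b j"]
  by (metis less_eq_real_def mult_nonpos_nonneg not_less zero_less_one)

lemma q_eq: "j \<ge> 1 \<Longrightarrow> q j = 1 / bdry_energy \<Omega> (b j)"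
  using q_mult_bdry_energy[of j] by (metis nonzero_eq_divide_eq mult_zero_right zero_neq_one)

text \<open>A later eigenfunction satisfies the constraints of every earlier maximisation problem, so its boundary
  energy \<open>1 / q\<close> cannot exceed the earlier maximum.\<close>

lemma q_mono:
  assumes "1 \<le> j" "j \<le> k"
  shows "q j \<le> q k"
proof -
  have k: "k \<ge> 1" using assms by simp
  have "b k \<in> admissible \<Omega> b j"
    using orthonormal assms k by (auto simp: admissible_def Delta_orthonormal_def norm_Delta_def)
  then have "bdry_energy \<Omega> (b k) \<le> bdry_energy \<Omega> (b j)"
    using constructed assms(1) by (simp add: DBS_constructed_def)
  moreover have "0 < bdry_energy \<Omega> (b k)"
    using q_mult_bdry_energy[OF k] bdry_energy_nonneg[of "b k"] by (metis less_eq_real_def mult_zero_right zero_neq_one)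
  ultimately show ?thesis
    using q_eq[OF assms(1)] q_eq[OF k] by (simp add: frac_le)
qed

text \<open>A boundary without area would carry no boundary energy, contradicting \<open>q j * bdry_energy \<Omega> (b j) = 1\<close>.\<close>

lemma area_pos: "0 < A"
proof (rule ccontr)
  assume "\<not> 0 < A"
  interpret finite_measure \<sigma>
    using B2 by (intro finite_surface_measure) (simp add: B2_def)
  have "measure \<sigma> (space \<sigma>) = 0"
    using \<open>\<not> 0 < A\<close> measure_nonneg[of \<sigma> "frontier \<Omega>"]
    by (simp add: surface_area_def space_surface_measure)
  then have "AE z in \<sigma>. \<bar>normal_deriv \<Omega> (b 1) z\<bar>\<^sup>2 = 0"
    by (intro AE_I[of _ _ "space \<sigma>"]) (auto simp: emeasure_eq_measure)
  then have "bdry_energy \<Omega> (b 1) = 0"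
    unfolding bdry_energy_def by (rule integral_eq_zero_AE)
  then show False using q_mult_bdry_energy[of 1] by simp
qed

lemma u_orthonormal: "L2_orthonormal \<sigma> {1..} u"
  unfolding L2_orthonormal_def
proof (intro conjI ballI)
  fix j :: nat assume j: "j \<in> {1..}"
  show "u j \<in> L2 \<sigma>"
    unfolding u_def[abs_def] using j by (intro L2_scale normal_deriv_L2 B2 b_H0Delta) simp
  fix k :: nat assume k: "k \<in> {1..}"
  have "(LINT z|\<sigma>. u j z * u k z)
      = (LINT z|\<sigma>. (sqrt (q j) * sqrt (q k)) * (normal_deriv \<Omega> (b j) z * normal_deriv \<Omega> (b k) z))"
    by (simp add: u_def mult_ac)
  also have "\<dots> = sqrt (q j) * sqrt (q k) * (LINT z|\<sigma>. normal_deriv \<Omega> (b j) z * normal_deriv \<Omega> (b k) z)"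
    by simp
  also have "\<dots> = (if j = k then 1 else 0)"
    using inner_normal_deriv[of j k] j k q_pos[of j] by (cases "j = k") auto
  finally show "(LINT z|\<sigma>. u j z * u k z) = (if j = k then 1 else 0)" .
qed

lemma h_orthonormal: "L2_orthonormal (lebesgue_on \<Omega>) {1..} (dbs_h \<Omega> b)"
  using orthonormal weak_laplacian_L2[OF b_H0Delta]
  by (simp add: L2_orthonormal_def dbs_h_def Delta_orthonormal_def inner_Delta_def)

lemma h_L2H:
  assumes "j \<ge> 1"
  shows "dbs_h \<Omega> b j \<in> L2H \<Omega>"
  unfolding L2H_def dbs_h_def
  using weak_laplacian_L2[OF b_H0Delta[OF assms]]
    harmonic_Laplacian_of_eigenfunction[OF open_\<Omega> B2 eigenpair[OF assms]] by simp

lemma dbs_w_eq: "j \<ge> 1 \<Longrightarrow> dbs_w \<Omega> b q j z = sqrt A * u j z"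
  by (simp add: dbs_w_def u_def real_sqrt_mult mult_ac)

lemma dbs_coeff_eq:
  assumes "j \<ge> 1"
  shows "dbs_coeff \<Omega> b q g j = (LINT z|\<sigma>. g z * u j z) / sqrt A"
proof -
  have "(LINT z|\<sigma>. g z * dbs_w \<Omega> b q j z) = (LINT z|\<sigma>. sqrt A * (g z * u j z))"
    using assms by (simp add: dbs_w_eq mult_ac)
  also have "\<dots> = sqrt A * (LINT z|\<sigma>. g z * u j z)" by simp
  finally have "dbs_coeff \<Omega> b q g j = sqrt A * (LINT z|\<sigma>. g z * u j z) / (sqrt A * sqrt A)"
    using area_pos by (simp add: dbs_coeff_def bdry_inner_def)
  then show ?thesis
    using area_pos by (simp del: real_sqrt_mult_self)
qed

text \<open>The factor \<open>sqrt |\<partial>\<Omega>|\<close> in front of the series cancels the one in the denominator of each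
  coefficient.\<close>

lemma harmonic_series_eq:
  "sqrt A * (\<Sum>j=1..n. dbs_coeff \<Omega> b q g j / sqrt (q j) * dbs_h \<Omega> b j x)
    = (\<Sum>j=1..n. (LINT z|\<sigma>. g z * u j z) / sqrt (q j) * dbs_h \<Omega> b j x)"
  unfolding sum_distrib_left using area_pos
  by (intro sum.cong) (auto simp: dbs_coeff_eq)

lemma extension_approx_eq:
  assumes g: "g \<in> L2 \<sigma>"
  shows "extension_approx \<Omega> b q M g x
    = (\<Sum>j=1..M. (LINT z|\<sigma>. g z * u j z) / sqrt (q j) * dbs_h \<Omega> b j x)"
proof -
  have "poisson_approx \<Omega> b q M x z = (\<Sum>j=1..M. dbs_h \<Omega> b j x / sqrt (q j) * u j z)" for z
    unfolding poisson_approx_def using area_pos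
    by (intro sum.cong) (auto simp: dbs_w_eq real_sqrt_mult)
  then have "extension_approx \<Omega> b q M g x
      = (\<Sum>j=1..M. dbs_h \<Omega> b j x / sqrt (q j) * (LINT z|\<sigma>. u j z * g z))"
    unfolding extension_approx_def using u_orthonormal g
    by (simp only:) (intro integral_sum_mult, auto simp: L2_orthonormal_def)
  then show ?thesis
    by (simp add: mult_ac)
qed

lemma bdry_approx_eq: "bdry_approx \<Omega> b q M g z = (\<Sum>j=1..M. (LINT z|\<sigma>. g z * u j z) * u j z)"
  unfolding bdry_approx_def using area_pos
  by (intro sum.cong) (auto simp: dbs_w_eq dbs_coeff_eq)

text \<open>Bessel's inequality and \<open>q 1 \<le> q j\<close> make the coefficients square summable, so the series has a limit;
  the limit is harmonic because the partial sums are.  Hence the choice in \<^const>\<open>harmonic_extension\<close>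
  is made from a nonempty set.\<close>

lemma harmonic_extension_converges:
  assumes g: "g \<in> L2 \<sigma>"
  shows "harmonic_extension \<Omega> b q g \<in> L2H \<Omega>"
    and "(\<lambda>n. L2_norm (lebesgue_on \<Omega>) (\<lambda>x. harmonic_extension \<Omega> b q g x
        - (\<Sum>j=1..n. (LINT z|\<sigma>. g z * u j z) / sqrt (q j) * dbs_h \<Omega> b j x))) \<longlonglongrightarrow> 0"
proof -
  let ?a = "\<lambda>j. (LINT z|\<sigma>. g z * u j z) / sqrt (q j)"
  let ?S = "\<lambda>n x. \<Sum>j=1..n. ?a j * dbs_h \<Omega> b j x"
  have "(\<Sum>j=1..n. (?a j)\<^sup>2) \<le> (LINT z|\<sigma>. (g z)\<^sup>2) / q 1" for n
  proof -
    have "(\<Sum>j=1..n. (?a j)\<^sup>2) \<le> (\<Sum>j=1..n. (LINT z|\<sigma>. g z * u j z)\<^sup>2 / q 1)"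
      using q_pos q_mono[of 1] by (intro sum_mono) (auto simp: power_divide less_imp_le intro!: frac_le)
    also have "\<dots> \<le> (LINT z|\<sigma>. (g z)\<^sup>2) / q 1"
      unfolding sum_divide_distrib[symmetric]
      using L2_Bessel[OF _ L2_orthonormal_subset[OF u_orthonormal] g, of "{1..n}"] q_pos[of 1]
      by (intro divide_right_mono) auto
    finally show ?thesis .
  qed
  from L2_orthonormal_series_converges[OF h_orthonormal this]
  obtain f where f: "f \<in> L2 (lebesgue_on \<Omega>)"
      "(\<lambda>n. L2_norm (lebesgue_on \<Omega>) (\<lambda>x. f x - ?S n x)) \<longlonglongrightarrow> 0"
    by blast
  have "?S n \<in> L2H \<Omega>" for n
    by (intro L2H_sum h_L2H open_\<Omega> bounded_\<Omega>) simp
  from L2H_closed[OF open_\<Omega> bounded_\<Omega> this f] f(2)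
  have "\<exists>f. f \<in> L2H \<Omega> \<and> (\<lambda>n. L2_norm (lebesgue_on \<Omega>) (\<lambda>x. f x - ?S n x)) \<longlonglongrightarrow> 0"
    by blast
  from someI_ex[OF this]
  show "harmonic_extension \<Omega> b q g \<in> L2H \<Omega>"
    and "(\<lambda>n. L2_norm (lebesgue_on \<Omega>) (\<lambda>x. harmonic_extension \<Omega> b q g x - ?S n x)) \<longlonglongrightarrow> 0"
    unfolding harmonic_extension_def harmonic_series_eq by blast+
qed

lemma harmonic_extension_error:
  assumes g: "g \<in> L2 \<sigma>"
  shows "L2_norm (lebesgue_on \<Omega>) (\<lambda>x. harmonic_extension \<Omega> b q g x - extension_approx \<Omega> b q M g x)
    \<le> sqrt (A / q (M + 1)) * bdry_norm \<Omega> (\<lambda>z. g z - bdry_approx \<Omega> b q M g z)"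
proof -
  have "harmonic_extension \<Omega> b q g \<in> L2 (lebesgue_on \<Omega>)"
    using harmonic_extension_converges(1)[OF g] by (simp add: L2H_def)
  from L2_orthonormal_tail_estimate[OF h_orthonormal u_orthonormal g refl q_pos q_mono this
      harmonic_extension_converges(2)[OF g], of M]
  have "L2_norm (lebesgue_on \<Omega>) (\<lambda>x. harmonic_extension \<Omega> b q g x - extension_approx \<Omega> b q M g x)
    \<le> sqrt ((LINT z|\<sigma>. (g z - bdry_approx \<Omega> b q M g z)\<^sup>2) / q (M + 1))"
    by (simp add: extension_approx_eq[OF g] bdry_approx_eq)
  also have "\<dots> = sqrt (A / q (M + 1)) * bdry_norm \<Omega> (\<lambda>z. g z - bdry_approx \<Omega> b q M g z)"
    using area_pos by (simp add: bdry_norm_def bdry_inner_def power2_eq_square flip: real_sqrt_mult)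
  finally show ?thesis .
qed

end

theorem theorem7p3:
  fixes \<Omega> :: "(real ^ 'n) set"
    and b :: "nat \<Rightarrow> real ^ 'n \<Rightarrow> real"
    and q :: "nat \<Rightarrow> real"
    and M :: nat
  assumes "CARD('n) \<ge> 2"
    and "region \<Omega>"
    and "B2 \<Omega>"
    and "DBS_constructed \<Omega> b q"
    and "Delta_orthonormal \<Omega> b"
    and "\<And>j. j \<ge> 1 \<Longrightarrow> DBS_eigenpair \<Omega> (q j) (b j)"
    and "M \<ge> 1"
  shows "\<forall>g \<in> L2 (surface_measure \<Omega>).
    L2_norm (lebesgue_on \<Omega>) (\<lambda>x. harmonic_extension \<Omega> b q g x - extension_approx \<Omega> b q M g x)
      \<le> sqrt (surface_area \<Omega> / q (M + 1)) * bdry_norm \<Omega> (\<lambda>z. g z - bdry_approx \<Omega> b q M g z)"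
proof
  fix g assume g: "g \<in> L2 (surface_measure \<Omega>)"
  interpret DBS_system \<Omega> b q
    using assms by unfold_locales (auto simp: region_def)
  show "L2_norm (lebesgue_on \<Omega>) (\<lambda>x. harmonic_extension \<Omega> b q g x - extension_approx \<Omega> b q M g x)
      \<le> sqrt (surface_area \<Omega> / q (M + 1)) * bdry_norm \<Omega> (\<lambda>z. g z - bdry_approx \<Omega> b q M g z)"
    using g by (rule harmonic_extension_error)
qed

end
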